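(* Let $X$ be a computable metric space and let $M$ be a computable Banach space. Let $f:X\to M$ be total and externally computable. Then $f$ is internally computable.
   Context: All Banach spaces are real, and $\mathbb{N}$ starts with $0$. **Computable metric spaces and external computability.** A computable metric space $X$ is given as the completion of an enumerated set $\{x_n\mid n\in\mathbb{N}\}$ with a computable metric $d$ (the reals $d(x_n,x_m)$ are computable uniformly in $n,m$). A sequence $\{z_n\}_{n\in\mathbb{N}}$ in a metric space is fast converging if $d(z_n,z_{n+1})\le 2^{-n}$ for all $n$. A function $\gamma:\mathbb{N}\to\mathbb{N}$ represents $x\in X$ if $d(x_{\gamma(n)},x_{\gamma(n+1)})\le 2^{-n}$ for all $n$ and $x=\lim_n x_{\gamma(n)}$. A function $f:X\to Y$ between computable metric spaces is externally computable if there is a (Turing) computable partial functional $F:\mathbb{N}^{\mathbb{N}}\to\mathbb{N}^{\mathbb{N}}$ such that whenever $\gamma$ represents $x\in X$, $F(\gamma)$ is defined (total) and represents $f(x)$; functions of several arguments are treated in the same way. $\mathbb{R}$ is a computable metric space via an effective enumeration of $\mathbb{Q}$. A computable Banach space $M$ is a Banach space given as a computable metric space (the completion of an enumerated set $\{y_m\mid m\in\mathbb{N}\}$), the metric being given by the norm, with (externally) computable addition $+_M$ and multiplication by scalars $\cdot_M$. **Operators.** (Case) For partial functions $f,g$ from $\mathbb{R}$ to a set and $y\in\mathbb{R}$, $Case(f,g,y)(x)$ is $f(x)$ if $x<y$, $g(x)$ if $y<x$, $z$ if $x=y$ and $f(y)=g(y)=z$, and undefined if $x=y$ and $f(y)\ne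 g(y)$. (Modified limit) For a sequence $\{w_k\}_{k\in\mathbb{N}}$ in a Banach space let $w^m_0=w_0$ and $w^m_{k+1}=w^m_k+\lambda_k(w_{k+1}-w^m_k)$, where $\lambda_k=1$ if $\|w_{k+1}-w^m_k\|\le 2^{-k}$ and $\lambda_k=2^{-k}/\|w_{k+1}-w^m_k\|$ if $\|w_{k+1}-w^m_k\|\ge 2^{-k}$. The modified limit is $ml(\{w_k\}_k)=\lim_{k\to\infty}w^m_k$. (Accumulation) For $f:\mathbb{N}\to\mathbb{R}_{\ge 0}$ and $g:\mathbb{N}\to M$ ($M$ a Banach space), if $n$ is such that $\sum_{i=0}^{n-1}f(i)\le 1$ and $\sum_{i=0}^{n}f(i)>1$, then $\bar\alpha(f,g)=\sum_{i=0}^{n-1}f(i)g(i)+\lambda g(n)$ with $\lambda=1-\sum_{i=0}^{n-1}f(i)$ (so $\bar\alpha(f,g)=g(0)$ if $f(0)>1$); $\bar\alpha(f,g)$ is undefined if $\sum_{i=0}^\infty f(i)\le 1$. **Internal computability.** Let $X$ be the completion of $\{x_n\}$ with metric $d_X$, and let $M$, with $\|\cdot\|_M,+_M,\cdot_M$, be the completion of $\{y_m\}$. The set of internally computable functions from any product of the sets $\mathbb{N},\mathbb{R},X,M$ to any of these sets is the smallest class of partial functions containing the following basic functions and constants (dummy arguments of all kinds allowed in the basic functions): - successor and constants on $\mathbb{N}$; - the constant $1$ in $\mathbb{R}$; - addition, subtraction, multiplication and absolute value on $\mathbb{R}$; - $n\mapsto x_n$ and $d_X:X^2\to\mathbb{R}$;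 - $m\mapsto y_m$, $+_M:M^2\to M$, $\cdot_M:\mathbb{R}\times M\to M$ and $\|\cdot\|_M:M\to\mathbb{R}$; and closed under composition, primitive recursion (on an argument in $\mathbb{N}$, with values in any of these sets), $\mu$-recursion (over $\mathbb{N}$), the Case operator, the modified limit operator for $\mathbb{R}$ and $M$, and the accumulation operator $\bar\alpha$ for $\mathbb{R}$ and $M$. (Closure under these operators is understood with parameters: e.g. if $\varphi(n,\vec z)$ is internally computable with values in $M$, then so is $\vec z\mapsto ml(\{\varphi(n,\vec z)\}_n)$.) *)

theory Defs
  imports "HOL-Analysis.Analysis" "HOL-Library.Nat_Bijection"
begin

section \<open>Recursion schemes for partial functions\<close>

primrec prec_opt :: "'v option \<Rightarrow> (nat \<Rightarrow> 'v \<Rightarrow> 'v option) \<Rightarrow> nat \<Rightarrow> 'v option" where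
  "prec_opt a h 0 = a"
| "prec_opt a h (Suc n) = Option.bind (prec_opt a h n) (h n)"

text \<open>Minimisation requires all values below the zero to be defined.\<close>

definition mu_opt :: "(nat \<Rightarrow> nat option) \<Rightarrow> nat option" where
  "mu_opt p =
     (if \<exists>n. p n = Some 0 \<and> (\<forall>m<n. p m \<noteq> None)
      then Some (LEAST n. p n = Some 0) else None)"


section \<open>Computable functionals\<close>

text \<open>
  Turing computability relative to function oracles, rendered by Kleene's scheme: the partial
  functions of \<open>n\<close> natural numbers that are \<open>\<mu>\<close>-recursive in \<open>k\<close> oracles, uniformly in the
  oracles. A functional from (\<open>k\<close>-tuples of) sequences to sequences is given by its curried form
  with \<open>n = 1\<close>; for \<open>k = 0\<close> these are the partial recursive functions. Argument lists of length
  other than \<open>n\<close> are outside the domain.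
\<close>

inductive computable_functional ::
  "nat \<Rightarrow> nat \<Rightarrow> ((nat \<Rightarrow> nat) list \<Rightarrow> nat list \<Rightarrow> nat option) \<Rightarrow> bool"
  for k :: nat where
  cf_zero: "computable_functional k 0 (\<lambda>\<gamma>s ns. if ns = [] then Some 0 else None)"
| cf_suc: "computable_functional k 1
    (\<lambda>\<gamma>s ns. case ns of [n] \<Rightarrow> Some (Suc n) | _ \<Rightarrow> None)"
| cf_proj: "i < n \<Longrightarrow> computable_functional k n
    (\<lambda>\<gamma>s ns. if length ns = n then Some (ns ! i) else None)"
| cf_oracle: "i < k \<Longrightarrow> computable_functional k 1
    (\<lambda>\<gamma>s ns. case ns of [n] \<Rightarrow> Some ((\<gamma>s ! i) n) | _ \<Rightarrow> None)"
| cf_comp: "computable_functional k (length Gs) F \<Longrightarrow>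
    (\<forall>G\<in>set Gs. computable_functional k n G) \<Longrightarrow>
    computable_functional k n
      (\<lambda>\<gamma>s ns. if length ns = n
                then Option.bind (those (map (\<lambda>G. G \<gamma>s ns) Gs)) (F \<gamma>s) else None)"
| cf_prec: "computable_functional k n G \<Longrightarrow> computable_functional k (Suc (Suc n)) H \<Longrightarrow>
    computable_functional k (Suc n)
      (\<lambda>\<gamma>s ns. case ns of
         i # ms \<Rightarrow> prec_opt (G \<gamma>s ms) (\<lambda>j v. H \<gamma>s (j # v # ms)) i
       | [] \<Rightarrow> None)"
| cf_mu: "computable_functional k (Suc n) F \<Longrightarrow>
    computable_functional k n (\<lambda>\<gamma>s ns. mu_opt (\<lambda>i. F \<gamma>s (i # ns)))"


section \<open>Computable metric spaces and external computability\<close>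

definition represents ::
  "(nat \<Rightarrow> 'a::metric_space) \<Rightarrow> (nat \<Rightarrow> nat) \<Rightarrow> 'a \<Rightarrow> bool" where
  "represents x \<gamma> p \<longleftrightarrow>
     (\<forall>n. dist (x (\<gamma> n)) (x (\<gamma> (Suc n))) \<le> (1/2) ^ n) \<and> (\<lambda>n. x (\<gamma> n)) \<longlonglongrightarrow> p"

text \<open>The effective enumeration of the rationals that makes the reals a computable metric space.\<close>

definition rat_enum :: "nat \<Rightarrow> real" where
  "rat_enum n = (case prod_decode n of (a, b) \<Rightarrow> real_of_int (int_decode a) / real (Suc b))"

lemma range_rat_enum: "range rat_enum = \<rat>"
proof
  show "range rat_enum \<subseteq> \<rat>"
    by (auto simp: rat_enum_def split: prod.split)
next
  show "\<rat> \<subseteq> range rat_enum"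
  proof
    fix r :: real
    assume "r \<in> \<rat>"
    then obtain i :: int and b :: nat where "b \<noteq> 0" and r: "r = real_of_int i / real b"
      by (auto simp: Rats_eq_int_div_nat)
    then have "r = rat_enum (prod_encode (int_encode i, b - 1))"
      by (simp add: rat_enum_def)
    then show "r \<in> range rat_enum" by blast
  qed
qed

text \<open>
  A complete space is the completion of an enumerated set exactly if the enumeration is dense.
\<close>

definition computable_metric_space :: "(nat \<Rightarrow> 'a::complete_space) \<Rightarrow> bool" where
  "computable_metric_space x \<longleftrightarrow>
     closure (range x) = UNIV \<and>
     (\<exists>D. computable_functional 0 3 D \<and>
        (\<forall>n m. \<exists>\<delta>. (\<forall>i. D [] [n, m, i] = Some (\<delta> i)) \<and>
                    represents rat_enum \<delta> (dist (x n) (x m))))"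

definition externally_computable ::
  "(nat \<Rightarrow> 'a::metric_space) \<Rightarrow> (nat \<Rightarrow> 'b::metric_space) \<Rightarrow> ('a \<Rightarrow> 'b) \<Rightarrow> bool" where
  "externally_computable x y f \<longleftrightarrow>
     (\<exists>F. computable_functional 1 1 F \<and>
        (\<forall>\<gamma> p. represents x \<gamma> p \<longrightarrow>
           (\<exists>\<delta>. (\<forall>n. F [\<gamma>] [n] = Some (\<delta> n)) \<and> represents y \<delta> (f p))))"

definition externally_computable2 ::
  "(nat \<Rightarrow> 'a::metric_space) \<Rightarrow> (nat \<Rightarrow> 'b::metric_space) \<Rightarrow> (nat \<Rightarrow> 'c::metric_space)
   \<Rightarrow> ('a \<Rightarrow> 'b \<Rightarrow> 'c) \<Rightarrow> bool" where
  "externally_computable2 x y z f \<longleftrightarrow>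
     (\<exists>F. computable_functional 2 1 F \<and>
        (\<forall>\<gamma> \<gamma>' p q. represents x \<gamma> p \<longrightarrow> represents y \<gamma>' q \<longrightarrow>
           (\<exists>\<delta>. (\<forall>n. F [\<gamma>, \<gamma>'] [n] = Some (\<delta> n)) \<and> represents z \<delta> (f p q))))"

definition computable_banach_space :: "(nat \<Rightarrow> 'm::banach) \<Rightarrow> bool" where
  "computable_banach_space y \<longleftrightarrow>
     computable_metric_space y \<and>
     externally_computable2 y y y (+) \<and>
     externally_computable2 rat_enum y y scaleR"


section \<open>The operators\<close>

definition case_op :: "(real \<Rightarrow> 'v option) \<Rightarrow> (real \<Rightarrow> 'v option) \<Rightarrow> real \<Rightarrow> real \<Rightarrow> 'v option" where
  "case_op f g y x =
     (if x < y then f x else if y < x then g x else if f y = g y then f y else None)"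

primrec modified_seq :: "(nat \<Rightarrow> 'a::banach) \<Rightarrow> nat \<Rightarrow> 'a" where
  "modified_seq w 0 = w 0"
| "modified_seq w (Suc k) =
     (let v = modified_seq w k; r = norm (w (Suc k) - v)
      in v + (if r \<le> (1/2) ^ k then 1 else (1/2) ^ k / r) *\<^sub>R (w (Suc k) - v))"

text \<open>
  The modified sequence is always Cauchy, so the modified limit is defined exactly if the given
  sequence is total.
\<close>

definition modified_limit :: "(nat \<Rightarrow> 'a::banach option) \<Rightarrow> 'a option" where
  "modified_limit w =
     (if \<forall>n. w n \<noteq> None then Some (lim (modified_seq (\<lambda>n. the (w n)))) else None)"

text \<open>
  Accumulation takes total sequences, the first one nonnegative; it is undefined if one of them is
  partial, even if the missing values would have weight zero.
\<close>

definition accumulation :: "(nat \<Rightarrow> real option) \<Rightarrow> (nat \<Rightarrow> 'a::banach option) \<Rightarrow> 'a option" where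
  "accumulation f g =
     (if (\<forall>i. \<exists>a\<ge>0. f i = Some a) \<and> (\<forall>i. g i \<noteq> None) \<and> (\<exists>n. 1 < (\<Sum>i\<le>n. the (f i)))
      then let n = (THE n. (\<Sum>i<n. the (f i)) \<le> 1 \<and> 1 < (\<Sum>i\<le>n. the (f i)))
           in Some ((\<Sum>i<n. the (f i) *\<^sub>R the (g i)) + (1 - (\<Sum>i<n. the (f i))) *\<^sub>R the (g n))
      else None)"


section \<open>Internal computability\<close>

datatype kind = Nat_kind | Real_kind | X_kind | M_kind

datatype ('x, 'm) val =
  NatV (the_nat: nat) | RealV (the_real: real) | XV (the_X: 'x) | MV (the_M: 'm)

primrec kind_of :: "('x, 'm) val \<Rightarrow> kind" where
  "kind_of (NatV _) = Nat_kind"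
| "kind_of (RealV _) = Real_kind"
| "kind_of (XV _) = X_kind"
| "kind_of (MV _) = M_kind"

definition on_kinds ::
  "kind list \<Rightarrow> (('x, 'm) val list \<Rightarrow> ('x, 'm) val option) \<Rightarrow> ('x, 'm) val list \<Rightarrow> ('x, 'm) val option"
  where "on_kinds ss f vs = (if map kind_of vs = ss then f vs else None)"

text \<open>
  \<open>internally_computable x y ss t f\<close>: the partial function \<open>f\<close>, from the product of the sets named
  by \<open>ss\<close> to the set named by \<open>t\<close>, is internally computable. A partial function is undefined on
  argument lists that do not match \<open>ss\<close>. Dummy arguments are obtained by composition with
  projections; in particular, composition with an empty list of functions adds dummy arguments
  to a constant. Composition is strict. In the rules for the operators the remaining arguments
  \<open>us\<close> are the parameters; the break point of the case operator is itself an argument.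
\<close>

inductive internally_computable ::
  "(nat \<Rightarrow> 'x::complete_space) \<Rightarrow> (nat \<Rightarrow> 'm::banach) \<Rightarrow> kind list \<Rightarrow> kind \<Rightarrow>
   (('x, 'm) val list \<Rightarrow> ('x, 'm) val option) \<Rightarrow> bool"
  for x :: "nat \<Rightarrow> 'x" and y :: "nat \<Rightarrow> 'm" where
  ic_proj: "i < length ss \<Longrightarrow>
    internally_computable x y ss (ss ! i) (on_kinds ss (\<lambda>vs. Some (vs ! i)))"
| ic_suc: "internally_computable x y [Nat_kind] Nat_kind
    (\<lambda>vs. case vs of [NatV n] \<Rightarrow> Some (NatV (Suc n)) | _ \<Rightarrow> None)"
| ic_const: "internally_computable x y [] Nat_kind (on_kinds [] (\<lambda>_. Some (NatV c)))"
| ic_one: "internally_computable x y [] Real_kind (on_kinds [] (\<lambda>_. Some (RealV 1)))"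
| ic_plus: "internally_computable x y [Real_kind, Real_kind] Real_kind
    (\<lambda>vs. case vs of [RealV a, RealV b] \<Rightarrow> Some (RealV (a + b)) | _ \<Rightarrow> None)"
| ic_minus: "internally_computable x y [Real_kind, Real_kind] Real_kind
    (\<lambda>vs. case vs of [RealV a, RealV b] \<Rightarrow> Some (RealV (a - b)) | _ \<Rightarrow> None)"
| ic_times: "internally_computable x y [Real_kind, Real_kind] Real_kind
    (\<lambda>vs. case vs of [RealV a, RealV b] \<Rightarrow> Some (RealV (a * b)) | _ \<Rightarrow> None)"
| ic_abs: "internally_computable x y [Real_kind] Real_kind
    (\<lambda>vs. case vs of [RealV a] \<Rightarrow> Some (RealV \<bar>a\<bar>) | _ \<Rightarrow> None)"
| ic_enum_X: "internally_computable x y [Nat_kind] X_kind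
    (\<lambda>vs. case vs of [NatV n] \<Rightarrow> Some (XV (x n)) | _ \<Rightarrow> None)"
| ic_dist_X: "internally_computable x y [X_kind, X_kind] Real_kind
    (\<lambda>vs. case vs of [XV p, XV q] \<Rightarrow> Some (RealV (dist p q)) | _ \<Rightarrow> None)"
| ic_enum_M: "internally_computable x y [Nat_kind] M_kind
    (\<lambda>vs. case vs of [NatV n] \<Rightarrow> Some (MV (y n)) | _ \<Rightarrow> None)"
| ic_plus_M: "internally_computable x y [M_kind, M_kind] M_kind
    (\<lambda>vs. case vs of [MV p, MV q] \<Rightarrow> Some (MV (p + q)) | _ \<Rightarrow> None)"
| ic_scale_M: "internally_computable x y [Real_kind, M_kind] M_kind
    (\<lambda>vs. case vs of [RealV a, MV p] \<Rightarrow> Some (MV (a *\<^sub>R p)) | _ \<Rightarrow> None)"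
| ic_norm_M: "internally_computable x y [M_kind] Real_kind
    (\<lambda>vs. case vs of [MV p] \<Rightarrow> Some (RealV (norm p)) | _ \<Rightarrow> None)"
| ic_comp: "internally_computable x y ts t f \<Longrightarrow>
    list_all2 (\<lambda>s g. internally_computable x y ss s g) ts gs \<Longrightarrow>
    internally_computable x y ss t
      (on_kinds ss (\<lambda>vs. Option.bind (those (map (\<lambda>g. g vs) gs)) f))"
| ic_prec: "internally_computable x y ss t g \<Longrightarrow>
    internally_computable x y (Nat_kind # t # ss) t h \<Longrightarrow>
    internally_computable x y (Nat_kind # ss) t
      (\<lambda>vs. case vs of
         NatV n # us \<Rightarrow> prec_opt (g us) (\<lambda>i v. h (NatV i # v # us)) n
       | _ \<Rightarrow> None)"
| ic_mu: "internally_computable x y (Nat_kind # ss) Nat_kind f \<Longrightarrow>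
    internally_computable x y ss Nat_kind
      (\<lambda>us. map_option NatV (mu_opt (\<lambda>n. map_option the_nat (f (NatV n # us)))))"
| ic_case: "internally_computable x y (Real_kind # ss) t f \<Longrightarrow>
    internally_computable x y (Real_kind # ss) t g \<Longrightarrow>
    internally_computable x y (Real_kind # Real_kind # ss) t
      (\<lambda>vs. case vs of
         RealV b # RealV a # us \<Rightarrow>
           case_op (\<lambda>r. f (RealV r # us)) (\<lambda>r. g (RealV r # us)) b a
       | _ \<Rightarrow> None)"
| ic_ml_R: "internally_computable x y (Nat_kind # ss) Real_kind w \<Longrightarrow>
    internally_computable x y ss Real_kind
      (\<lambda>us. map_option RealV (modified_limit (\<lambda>n. map_option the_real (w (NatV n # us)))))"
| ic_ml_M: "internally_computable x y (Nat_kind # ss) M_kind w \<Longrightarrow>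
    internally_computable x y ss M_kind
      (\<lambda>us. map_option MV (modified_limit (\<lambda>n. map_option the_M (w (NatV n # us)))))"
| ic_acc_R: "internally_computable x y (Nat_kind # ss) Real_kind f \<Longrightarrow>
    internally_computable x y (Nat_kind # ss) Real_kind g \<Longrightarrow>
    internally_computable x y ss Real_kind
      (\<lambda>us. map_option RealV
         (accumulation (\<lambda>n. map_option the_real (f (NatV n # us)))
                       (\<lambda>n. map_option the_real (g (NatV n # us)))))"
| ic_acc_M: "internally_computable x y (Nat_kind # ss) Real_kind f \<Longrightarrow>
    internally_computable x y (Nat_kind # ss) M_kind g \<Longrightarrow>
    internally_computable x y ss M_kind
      (\<lambda>us. map_option MV
         (accumulation (\<lambda>n. map_option the_real (f (NatV n # us)))
                       (\<lambda>n. map_option the_M (g (NatV n # us)))))"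

end

theory Submission
  imports Defs "HOL-Library.Discrete_Functions"
begin

text \<open>
  Let \<open>F\<close> be a machine that turns names of \<open>p\<close> into names of \<open>f p\<close>. On any particular name of
  \<open>p\<close>, the \<open>n\<close>-th output of \<open>F\<close> is \<open>2 * (1/2) ^ n\<close>-close to \<open>f p\<close>, but different names of \<open>p\<close> give
  different outputs, and in general no name of \<open>p\<close> can be selected continuously in
  \<open>p\<close>. So the outputs are averaged over all names. A finite prefix of a name already determines
  an output once \<open>F\<close> halts without looking beyond the prefix, so the average is a countable one.

  Give a prefix \<open>\<sigma> 0, ..., \<sigma> t\<close> the weight \<open>prefix_weight\<close>: a product of positive parts of real
  terms in distances, which is positive exactly if \<open>dist (x (\<sigma> j)) (x (\<sigma> (j+1))) < (1/2) ^ j\<close> for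
  \<open>j < t\<close> and \<open>dist (x (\<sigma> t)) p < (1/2) ^ t\<close>. Because the inequalities are strict, a prefix of
  positive weight can be continued to a name of \<open>p\<close> (\<open>name_extends_prefix\<close>), so the output that \<open>F\<close>
  computes from it is a good approximation of \<open>f p\<close>. Prefixes on which \<open>F\<close> has not halted get
  weight \<open>0\<close>. Conversely every \<open>p\<close> has a name all of whose prefixes have positive weight
  (\<open>strict_name\<close>), and \<open>F\<close> halts on one of them. Each prefix is listed infinitely often, hence the
  weights have infinite sum, and accumulation forms a convex combination of good
  approximations (\<open>accumulation_near\<close>). These combinations \<open>u k p\<close> are within \<open>(1/2) ^ (k + 2)\<close> of
  \<open>f p\<close>, which is fast enough for the modified limit to be the limit (\<open>lim_modified_seq\<close>).

  Accumulation needs all weights and all values to be defined, so the machine cannot be run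
  directly: a computation that does not halt would make the average undefined. What is needed
  is a total function that simulates \<open>F\<close> for a bounded time on a finite prefix of the oracle. It
  is found by induction on the definition of computability (\<open>stage_evaluation\<close>), and it is
  internally computable because the internally computable functions are closed under
  composition, primitive recursion and minimisation.
\<close>

section \<open>Coding finite sequences\<close>

text \<open>
  Any coding of finite sequences by numbers will do whose decoding is easily seen to be
  recursive. With \<open>s = a + b\<close>, the code \<open>s\<^sup>2 + a\<close> of the pair \<open>(a, b)\<close> lies in
  \<open>{s\<^sup>2..<(s + 1)\<^sup>2}\<close>, so \<open>s\<close> is its square root rounded down.
\<close>

definition pair_code :: "nat \<Rightarrow> nat \<Rightarrow> nat" where
  "pair_code a b = (a + b)\<^sup>2 + a"

definition fst_code :: "nat \<Rightarrow> nat" where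
  "fst_code c = c - (floor_sqrt c)\<^sup>2"

definition snd_code :: "nat \<Rightarrow> nat" where
  "snd_code c = floor_sqrt c - fst_code c"

text \<open>
  A number is read as the infinite sequence of first components of its iterated second
  components; a prefix is then a number together with a length.
\<close>

definition entry :: "nat \<Rightarrow> nat \<Rightarrow> nat" where
  "entry c j = fst_code ((snd_code ^^ j) c)"

lemma floor_sqrt_pair_code: "floor_sqrt (pair_code a b) = a + b"
  by (rule floor_sqrt_unique) (auto simp: pair_code_def power2_eq_square)

lemma fst_pair_code [simp]: "fst_code (pair_code a b) = a"
  by (simp add: fst_code_def floor_sqrt_pair_code) (simp add: pair_code_def)

lemma snd_pair_code [simp]: "snd_code (pair_code a b) = b"
  by (simp add: snd_code_def floor_sqrt_pair_code)

lemma exists_code: "\<exists>c. \<forall>j<n. entry c j = \<gamma> j"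
proof (induction n arbitrary: \<gamma>)
  case (Suc n)
  obtain c where c: "entry c j = \<gamma> (Suc j)" if "j < n" for j
    using Suc[of "\<lambda>j. \<gamma> (Suc j)"] by blast
  have "entry (pair_code (\<gamma> 0) c) j = \<gamma> j" if "j < Suc n" for j
    using that c by (cases j) (auto simp: entry_def funpow_Suc_right simp del: funpow.simps)
  then show ?case by blast
qed simp

section \<open>Averages and limits in a Banach space\<close>

text \<open>
  The accumulated value is a convex combination of values of positive weight: the coefficients
  sum to \<open>1\<close> by the choice of the last one, which is smaller than the weight \<open>a n\<close> it
  replaces, so that \<open>a n\<close> is positive too.
\<close>

lemma accumulation_near:
  fixes g :: "nat \<Rightarrow> 'a::banach"
  assumes nonneg: "\<And>i. 0 \<le> a i" and ex: "\<exists>n. 1 < (\<Sum>i\<le>n. a i)"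
    and near: "\<And>i. 0 < a i \<Longrightarrow> norm (g i - v) \<le> \<delta>"
  shows "\<exists>u. accumulation (\<lambda>i. Some (a i)) (\<lambda>i. Some (g i)) = Some u \<and> norm (u - v) \<le> \<delta>"
proof -
  define n where "n = (LEAST n. 1 < (\<Sum>i\<le>n. a i))"
  have above: "1 < (\<Sum>i\<le>n. a i)"
    unfolding n_def using ex by (rule LeastI_ex)
  have below: "(\<Sum>i<n. a i) \<le> 1"
  proof (cases n)
    case (Suc k)
    then have "\<not> 1 < (\<Sum>i\<le>k. a i)"
      using not_less_Least[of k "\<lambda>n. 1 < (\<Sum>i\<le>n. a i)"] by (simp add: n_def)
    then show ?thesis by (simp add: Suc lessThan_Suc_atMost)
  qed simp
  have the_n: "(THE n. (\<Sum>i<n. a i) \<le> 1 \<and> 1 < (\<Sum>i\<le>n. a i)) = n"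
  proof (rule the_equality)
    fix m assume m: "(\<Sum>i<m. a i) \<le> 1 \<and> 1 < (\<Sum>i\<le>m. a i)"
    then have "n \<le> m" unfolding n_def by (intro Least_le) simp
    moreover have "\<not> n < m"
    proof
      assume "n < m"
      then have "(\<Sum>i\<le>n. a i) \<le> (\<Sum>i<m. a i)"
        by (intro sum_mono2) (auto simp: nonneg)
      with m above show False by linarith
    qed
    ultimately show "m = n" by simp
  qed (use above below in simp)
  define b where "b = 1 - (\<Sum>i<n. a i)"
  have b: "0 \<le> b" "b < a n"
    using above below by (simp_all add: b_def flip: lessThan_Suc_atMost)
  define u where "u = (\<Sum>i<n. a i *\<^sub>R g i) + b *\<^sub>R g n"
  have "accumulation (\<lambda>i. Some (a i)) (\<lambda>i. Some (g i)) = Some u"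
    using ex nonneg by (simp add: accumulation_def the_n u_def b_def)
  moreover have "u - v = (\<Sum>i<n. a i *\<^sub>R (g i - v)) + b *\<^sub>R (g n - v)"
    by (simp add: u_def b_def algebra_simps sum_subtractf flip: scaleR_sum_left)
  moreover have "norm (\<Sum>i<n. a i *\<^sub>R (g i - v)) \<le> (\<Sum>i<n. a i * \<delta>)"
  proof (rule sum_norm_le)
    fix i
    show "norm (a i *\<^sub>R (g i - v)) \<le> a i * \<delta>"
      using nonneg[of i] near[of i] by (cases "a i = 0") (auto intro: mult_left_mono)
  qed
  moreover have "norm (b *\<^sub>R (g n - v)) \<le> b * \<delta>"
    using b near[of n] by (auto intro: mult_left_mono)
  ultimately have "norm (u - v) \<le> (\<Sum>i<n. a i * \<delta>) + b * \<delta>"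
    by (metis (no_types, lifting) add_mono norm_triangle_ineq order_trans)
  also have "\<dots> = \<delta>"
    by (simp add: b_def algebra_simps flip: sum_distrib_left)
  finally show ?thesis
    using \<open>accumulation _ _ = Some u\<close> by blast
qed

lemma partial_sum_exceeds_1:
  fixes a :: "nat \<Rightarrow> real"
  assumes nonneg: "\<And>i. 0 \<le> a i" and "infinite S" and "0 < w" and w: "\<And>i. i \<in> S \<Longrightarrow> w \<le> a i"
  shows "\<exists>n. 1 < (\<Sum>i\<le>n. a i)"
proof -
  obtain k :: nat where k: "1 < real k * w"
    using \<open>0 < w\<close> reals_Archimedean3 by blast
  obtain T where T: "finite T" "T \<subseteq> S" "card T = k"
    using infinite_arbitrarily_large[OF \<open>infinite S\<close>] by blast
  have "real k * w \<le> (\<Sum>i\<in>T. a i)"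
    using T w by (metis subsetD sum_bounded_below)
  also have "\<dots> \<le> (\<Sum>i\<le>Max T. a i)"
    using T(1) by (intro sum_mono2) (auto simp: nonneg)
  finally show ?thesis
    using k by (meson order_less_le_trans)
qed

text \<open>
  Consecutive members are within \<open>(1/2) ^ (k + 2) + (1/2) ^ (k + 3) \<le> (1/2) ^ k\<close> of each
  other, so the modification never shortens a step and the modified sequence is \<open>w\<close> itself.
\<close>

lemma lim_modified_seq:
  fixes w :: "nat \<Rightarrow> 'a::banach"
  assumes near: "\<And>k. norm (w k - v) \<le> (1/2) ^ (k + 2)"
  shows "lim (modified_seq w) = v"
proof -
  have step: "norm (w (Suc k) - w k) \<le> (1/2) ^ k" for k
  proof -
    have "norm (w (Suc k) - w k) \<le> norm (w (Suc k) - v) + norm (w k - v)"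
      using norm_triangle_ineq4[of "w (Suc k) - v" "w k - v"] by simp
    also have "\<dots> \<le> (1/2) ^ (Suc k + 2) + (1/2) ^ (k + 2)"
      by (intro add_mono near)
    also have "\<dots> \<le> (1/2) ^ k" by simp
    finally show ?thesis .
  qed
  have "modified_seq w k = w k" for k
    by (induction k) (use step in \<open>auto simp: Let_def\<close>)
  then have "modified_seq w = w" by (rule ext)
  moreover have "w \<longlonglongrightarrow> v"
  proof (rule LIM_zero_cancel, rule Lim_null_comparison)
    show "\<forall>\<^sub>F k in sequentially. norm (w k - v) \<le> (1/2) ^ (k + 2)"
      using near by simp
    show "(\<lambda>k. (1/2) ^ (k + 2)) \<longlonglongrightarrow> (0::real)"
      by (intro LIMSEQ_ignore_initial_segment LIMSEQ_realpow_zero) auto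
  qed
  ultimately show ?thesis by (simp add: limI)
qed

section \<open>Names of a point and their prefixes\<close>

lemma represents_dist:
  assumes "represents y \<delta> q"
  shows "dist (y (\<delta> n)) q \<le> 2 * (1/2) ^ n"
proof (rule LIMSEQ_le_const2)
  have "(\<lambda>m. y (\<delta> (m + n))) \<longlonglongrightarrow> q"
    using assms by (intro LIMSEQ_ignore_initial_segment) (simp add: represents_def)
  then show "(\<lambda>m. dist (y (\<delta> n)) (y (\<delta> (m + n)))) \<longlonglongrightarrow> dist (y (\<delta> n)) q"
    by (intro tendsto_intros)
  have "dist (y (\<delta> n)) (y (\<delta> (m + n))) \<le> 2 * (1/2) ^ n - 2 * (1/2) ^ (m + n)" for m
  proof (induction m)
    case (Suc m)
    have "dist (y (\<delta> n)) (y (\<delta> (Suc m + n))) \<le>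
        dist (y (\<delta> n)) (y (\<delta> (m + n))) + dist (y (\<delta> (m + n))) (y (\<delta> (Suc (m + n))))"
      using dist_triangle by simp
    also have "\<dots> \<le> (2 * (1/2) ^ n - 2 * (1/2) ^ (m + n)) + (1/2) ^ (m + n)"
      using assms by (intro add_mono Suc) (simp add: represents_def)
    finally show ?case by simp
  qed simp
  then show "\<exists>N. \<forall>m\<ge>N. dist (y (\<delta> n)) (y (\<delta> (m + n))) \<le> 2 * (1/2) ^ n"
    by (meson diff_le_self dual_order.trans le_diff_eq zero_le_power zero_le_divide_1_iff
        zero_le_numeral mult_nonneg_nonneg le_add_same_cancel1)
qed

lemma dense_name:
  fixes x :: "nat \<Rightarrow> 'a::metric_space"
  assumes "closure (range x) = UNIV" and "\<And>j. 0 < \<epsilon> j"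
  shows "\<exists>\<gamma>. \<forall>j. dist (x (\<gamma> j)) p < \<epsilon> j"
proof -
  have "\<forall>j. \<exists>i. dist (x i) p < \<epsilon> j"
    using assms closure_approachable[of p "range x"] by auto
  then show ?thesis by metis
qed

lemma represents_if_near:
  assumes "\<And>j. dist (x (\<gamma> j)) (x (\<gamma> (Suc j))) \<le> (1/2) ^ j"
    and "\<And>j. t < j \<Longrightarrow> dist (x (\<gamma> j)) p < (1/2) ^ j"
  shows "represents x \<gamma> p"
proof -
  have e: "\<forall>\<^sub>F j in sequentially. dist (x (\<gamma> j)) p \<le> (1/2) ^ j"
    using eventually_gt_at_top[of t] by (rule eventually_mono) (rule less_imp_le, rule assms(2))
  have "(\<lambda>j. (1/2) ^ j) \<longlonglongrightarrow> (0::real)"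
    by (rule LIMSEQ_realpow_zero) auto
  then have "(\<lambda>j. dist (x (\<gamma> j)) p) \<longlonglongrightarrow> 0"
    by (intro tendsto_sandwich[OF _ e tendsto_const]) simp_all
  then have "(\<lambda>j. x (\<gamma> j)) \<longlonglongrightarrow> p"
    by (rule iffD2[OF tendsto_dist_iff])
  with assms(1) show ?thesis unfolding represents_def by blast
qed

text \<open>
  Choosing the \<open>j\<close>-th point within half of the tolerance \<open>(1/2) ^ j\<close> of \<open>p\<close> leaves room for the
  step to the next point. Strictness is what gives all prefixes of this name positive weight.
\<close>

lemma strict_name:
  fixes x :: "nat \<Rightarrow> 'a::metric_space"
  assumes "closure (range x) = UNIV"
  shows "\<exists>\<gamma>. represents x \<gamma> p \<and>
    (\<forall>j. dist (x (\<gamma> j)) (x (\<gamma> (Suc j))) < (1/2) ^ j \<and> dist (x (\<gamma> j)) p < (1/2) ^ j)"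
proof -
  obtain \<gamma> where \<gamma>: "\<And>j. dist (x (\<gamma> j)) p < (1/2) ^ (j + 1)"
    using dense_name[OF assms, of "\<lambda>j. (1/2) ^ (j + 1)" p] by auto
  have near: "dist (x (\<gamma> j)) p < (1/2) ^ j" for j
    using \<gamma>[of j] power_decreasing[of j "j + 1" "1/2 :: real"] by linarith
  have step: "dist (x (\<gamma> j)) (x (\<gamma> (Suc j))) < (1/2) ^ j" for j
  proof -
    have "dist (x (\<gamma> j)) (x (\<gamma> (Suc j))) \<le> dist (x (\<gamma> j)) p + dist (x (\<gamma> (Suc j))) p"
      by (rule dist_triangle2)
    also have "\<dots> < (1/2) ^ (j + 1) + (1/2) ^ (j + 1)"
      using \<gamma>[of j] near[of "Suc j"] by (intro add_strict_mono) simp_all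
    finally show ?thesis by simp
  qed
  show ?thesis
    using near step by (intro exI[of _ \<gamma>] conjI allI represents_if_near[of x \<gamma> 0] less_imp_le[OF step])
qed

text \<open>
  The strict inequality at \<open>t\<close> leaves a margin \<open>\<epsilon>\<close> for the step from \<open>\<sigma> t\<close> to the first new
  index. The new points are chosen \<open>\<epsilon>\<close>-close to \<open>p\<close> for this step and within half of their own
  tolerance for the later ones.
\<close>

lemma name_extends_prefix:
  fixes x :: "nat \<Rightarrow> 'a::metric_space"
  assumes dense: "closure (range x) = UNIV"
    and step: "\<And>j. j < t \<Longrightarrow> dist (x (\<sigma> j)) (x (\<sigma> (Suc j))) < (1/2) ^ j"
    and last: "dist (x (\<sigma> t)) p < (1/2) ^ t"
  shows "\<exists>\<gamma>. represents x \<gamma> p \<and> (\<forall>j\<le>t. \<gamma> j = \<sigma> j)"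
proof -
  define \<epsilon> where "\<epsilon> = (1/2) ^ t - dist (x (\<sigma> t)) p"
  obtain \<beta> where \<beta>: "\<And>j. dist (x (\<beta> j)) p < min \<epsilon> ((1/2) ^ (j + 1))"
    using dense_name[OF dense, of "\<lambda>j. min \<epsilon> ((1/2) ^ (j + 1))" p] last by (auto simp: \<epsilon>_def)
  define \<gamma> where "\<gamma> j = (if j \<le> t then \<sigma> j else \<beta> j)" for j
  have half: "dist (x (\<beta> j)) p < (1/2) ^ (j + 1)" for j
    using \<beta>[of j] by simp
  have near: "dist (x (\<beta> j)) p < (1/2) ^ j" for j
    using half[of j] power_decreasing[of j "j + 1" "1/2 :: real"] by linarith
  have "dist (x (\<gamma> j)) (x (\<gamma> (Suc j))) \<le> (1/2) ^ j" for j
  proof (cases j t rule: linorder_cases)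
    case less
    then show ?thesis using step[of j] by (simp add: \<gamma>_def)
  next
    case equal
    have "dist (x (\<sigma> t)) (x (\<beta> (Suc t))) \<le> dist (x (\<sigma> t)) p + dist (x (\<beta> (Suc t))) p"
      by (rule dist_triangle2)
    also have "\<dots> \<le> (1/2) ^ t"
      using \<beta>[of "Suc t"] by (simp add: \<epsilon>_def)
    finally show ?thesis using equal by (simp add: \<gamma>_def)
  next
    case greater
    have "dist (x (\<beta> j)) (x (\<beta> (Suc j))) \<le> dist (x (\<beta> j)) p + dist (x (\<beta> (Suc j))) p"
      by (rule dist_triangle2)
    also have "\<dots> \<le> (1/2) ^ (j + 1) + (1/2) ^ (j + 1)"
      using half[of j] near[of "Suc j"] by (intro add_mono) auto
    finally show ?thesis using greater by (simp add: \<gamma>_def)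
  qed
  moreover have "dist (x (\<gamma> j)) p < (1/2) ^ j" if "t < j" for j
    using that near[of j] by (simp add: \<gamma>_def)
  ultimately have "represents x \<gamma> p"
    by (rule represents_if_near)
  then show ?thesis
    by (intro exI[of _ \<gamma>]) (simp add: \<gamma>_def)
qed

text \<open>
  Up to a factor \<open>2\<close>, each factor is the positive part of a slack. Multiplying the distances
  by \<open>2 ^ j\<close> avoids the constant \<open>1/2\<close>, so that all factors are built from \<open>1\<close> and
  distances by ring operations and absolute values.
\<close>

definition prefix_weight :: "(nat \<Rightarrow> 'a::metric_space) \<Rightarrow> nat \<Rightarrow> nat \<Rightarrow> 'a \<Rightarrow> real" where
  "prefix_weight x c t p =
     (\<Prod>j<t. let r = 1 - 2 ^ j * dist (x (entry c j)) (x (entry c (Suc j))) in r + \<bar>r\<bar>) *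
     (let r = 1 - 2 ^ t * dist (x (entry c t)) p in r + \<bar>r\<bar>)"

lemma prefix_weight_nonneg: "0 \<le> prefix_weight x c t p"
  unfolding prefix_weight_def Let_def by (intro mult_nonneg_nonneg prod_nonneg) auto

lemma prefix_weight_pos_iff:
  "0 < prefix_weight x c t p \<longleftrightarrow>
     (\<forall>j<t. dist (x (entry c j)) (x (entry c (Suc j))) < (1/2) ^ j) \<and>
     dist (x (entry c t)) p < (1/2) ^ t"
proof -
  have pos: "r + \<bar>r\<bar> \<noteq> 0 \<longleftrightarrow> 0 < r" for r :: real by linarith
  have scale: "0 < 1 - 2 ^ j * d \<longleftrightarrow> d < (1/2) ^ j" for j and d :: real
    by (simp add: power_one_over field_simps)
  have "0 < prefix_weight x c t p \<longleftrightarrow> prefix_weight x c t p \<noteq> 0"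
    using prefix_weight_nonneg[of x c t p] by linarith
  then show ?thesis
    unfolding prefix_weight_def Let_def
    by (simp only: mult_eq_0_iff de_Morgan_disj prod_zero_iff finite_lessThan simp_thms
        bex_simps ball_simps pos scale Ball_def lessThan_iff)
qed

section \<open>Total internally computable functions\<close>

context
  fixes x :: "nat \<Rightarrow> 'x::complete_space" and y :: "nat \<Rightarrow> 'm::banach"
begin

lemma kind_of_eq_iff:
  "kind_of v = Nat_kind \<longleftrightarrow> (\<exists>n. v = NatV n)" "kind_of v = Real_kind \<longleftrightarrow> (\<exists>r. v = RealV r)"
  "kind_of v = X_kind \<longleftrightarrow> (\<exists>p. v = XV p)" "kind_of v = M_kind \<longleftrightarrow> (\<exists>q. v = MV q)"
  by (cases v; simp)+

text \<open>
  Terms over an environment \<open>vs\<close> of values: restricting to total functions removes the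
  definedness conditions from all closure rules, which can then be applied term constructor by
  term constructor. Binding constructs evaluate their bodies in an environment extended at the
  front, so free variables occur there in the form \<open>drop 1 vs\<close> or \<open>drop 2 vs\<close>.
\<close>

definition total_ic ::
  "kind list \<Rightarrow> kind \<Rightarrow> (('x, 'm) val list \<Rightarrow> ('x, 'm) val) \<Rightarrow> bool" where
  "total_ic ss t g \<longleftrightarrow>
     (\<forall>vs. map kind_of vs = ss \<longrightarrow> kind_of (g vs) = t) \<and>
     internally_computable x y ss t (on_kinds ss (\<lambda>vs. Some (g vs)))"

abbreviation "nat_ic ss e \<equiv> total_ic ss Nat_kind (\<lambda>vs. NatV (e vs))"
abbreviation "real_ic ss e \<equiv> total_ic ss Real_kind (\<lambda>vs. RealV (e vs))"
abbreviation "X_ic ss e \<equiv> total_ic ss X_kind (\<lambda>vs. XV (e vs))"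
abbreviation "M_ic ss e \<equiv> total_ic ss M_kind (\<lambda>vs. MV (e vs))"

lemma total_ic_kind: "total_ic ss t g \<Longrightarrow> map kind_of vs = ss \<Longrightarrow> kind_of (g vs) = t"
  by (simp add: total_ic_def)

lemma total_ic_cong:
  assumes "total_ic ss t g" and "\<And>vs. map kind_of vs = ss \<Longrightarrow> g vs = g' vs"
  shows "total_ic ss t g'"
proof -
  have "on_kinds ss (\<lambda>vs. Some (g vs)) = on_kinds ss (\<lambda>vs. Some (g' vs))"
    using assms(2) by (auto simp: on_kinds_def)
  then show ?thesis
    using assms by (simp add: total_ic_def)
qed

lemma total_ic_proj: "i < length ss \<Longrightarrow> total_ic ss (ss ! i) (\<lambda>vs. vs ! i)"
  unfolding total_ic_def by (auto intro: ic_proj)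

lemma those_map_Some: "those (map (\<lambda>h. Some (g h)) hs) = Some (map g hs)"
  by (induction hs) auto

text \<open>
  Composition in the form that also serves the basic functions, which are partial functions on
  value lists; they only need to be defined on the values of the arguments.
\<close>

lemma total_ic_apply:
  assumes F: "internally_computable x y ts t F" and hs: "list_all2 (total_ic ss) ts hs"
    and val: "\<And>vs. map kind_of vs = ss \<Longrightarrow> F (map (\<lambda>h. h vs) hs) = Some (g vs) \<and> kind_of (g vs) = t"
  shows "total_ic ss t g"
proof -
  define Hs where "Hs = map (\<lambda>h. on_kinds ss (\<lambda>vs. Some (h vs))) hs"
  have "list_all2 (\<lambda>s g. internally_computable x y ss s g) ts Hs"
    using hs unfolding Hs_def list_all2_map2
    by (rule list_all2_mono) (simp add: total_ic_def)
  then have "internally_computable x y ss t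
      (on_kinds ss (\<lambda>vs. Option.bind (those (map (\<lambda>g. g vs) Hs)) F))"
    by (rule ic_comp[OF F])
  also have "on_kinds ss (\<lambda>vs. Option.bind (those (map (\<lambda>g. g vs) Hs)) F) =
      on_kinds ss (\<lambda>vs. Some (g vs))"
  proof
    fix vs :: "('x, 'm) val list"
    show "on_kinds ss (\<lambda>vs. Option.bind (those (map (\<lambda>g. g vs) Hs)) F) vs =
        on_kinds ss (\<lambda>vs. Some (g vs)) vs"
    proof (cases "map kind_of vs = ss")
      case True
      then have "map (\<lambda>g. g vs) Hs = map (\<lambda>h. Some (h vs)) hs"
        by (simp add: Hs_def on_kinds_def)
      then have "those (map (\<lambda>g. g vs) Hs) = Some (map (\<lambda>h. h vs) hs)"
        using those_map_Some[of "\<lambda>h. h vs" hs] by simp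
      then show ?thesis
        using True val[OF True] by (simp add: on_kinds_def)
    qed (simp add: on_kinds_def)
  qed
  finally show ?thesis
    using val by (simp add: total_ic_def)
qed

lemma total_ic_compose:
  assumes g: "total_ic ts t g" and hs: "list_all2 (total_ic ss) ts hs"
  shows "total_ic ss t (\<lambda>vs. g (map (\<lambda>h. h vs) hs))"
proof (rule total_ic_apply[OF _ hs])
  show "internally_computable x y ts t (on_kinds ts (\<lambda>vs. Some (g vs)))"
    using g by (simp add: total_ic_def)
  fix vs :: "('x, 'm) val list"
  assume vs: "map kind_of vs = ss"
  have "map kind_of (map (\<lambda>h. h vs) hs) = ts"
    using hs by (induction rule: list_all2_induct) (simp_all add: total_ic_kind[OF _ vs])
  with g show "on_kinds ts (\<lambda>vs. Some (g vs)) (map (\<lambda>h. h vs) hs) = Some (g (map (\<lambda>h. h vs) hs)) \<and>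
      kind_of (g (map (\<lambda>h. h vs) hs)) = t"
    using total_ic_kind by (simp add: on_kinds_def)
qed

lemma total_ic_weaken:
  assumes "total_ic ss t g"
  shows "total_ic (rs @ ss) t (\<lambda>vs. g (drop (length rs) vs))"
proof -
  let ?hs = "map (\<lambda>i (vs :: ('x, 'm) val list). vs ! (length rs + i)) [0..<length ss]"
  have "list_all2 (total_ic (rs @ ss)) ss ?hs"
  proof (rule list_all2_all_nthI)
    fix i assume "i < length ss"
    then show "total_ic (rs @ ss) (ss ! i) (?hs ! i)"
      using total_ic_proj[of "length rs + i" "rs @ ss"] by simp
  qed simp
  from total_ic_compose[OF assms this] show ?thesis
  proof (rule total_ic_cong)
    fix vs :: "('x, 'm) val list"
    assume "map kind_of vs = rs @ ss"
    then have "length vs = length rs + length ss"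
      by (metis length_append length_map)
    then have "map (\<lambda>h. h vs) ?hs = drop (length rs) vs"
      by (intro nth_equalityI) auto
    then show "g (map (\<lambda>h. h vs) ?hs) = g (drop (length rs) vs)"
      by simp
  qed
qed

lemma total_ic_weaken1: "total_ic ss t g \<Longrightarrow> total_ic (r # ss) t (\<lambda>vs. g (drop 1 vs))"
  using total_ic_weaken[of ss t g "[r]"] by simp

lemma total_ic_weaken2: "total_ic ss t g \<Longrightarrow> total_ic (r # s # ss) t (\<lambda>vs. g (drop 2 vs))"
  using total_ic_weaken[of ss t g "[r, s]"] by (simp add: numeral_2_eq_2)

lemma total_ic_identity: "list_all2 (total_ic ss) ss (map (\<lambda>i vs. vs ! i) [0..<length ss])"
  by (rule list_all2_all_nthI) (auto simp: total_ic_proj)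

lemma map_nth_kinds:
  "map kind_of vs = ss \<Longrightarrow> map (\<lambda>h. h vs) (map (\<lambda>i vs. vs ! i) [0..<length ss]) = vs"
  by (intro nth_equalityI) (auto dest: arg_cong[of _ _ length])

text \<open>
  This removes a leading argument by substituting a term for it; the schemes of the inductive
  definition recurse on the first argument itself, their term versions on any term.
\<close>

lemma total_ic_let:
  assumes "total_ic ss s b" and "total_ic (s # ss) t g"
  shows "total_ic ss t (\<lambda>vs. g (b vs # vs))"
proof -
  let ?hs = "b # map (\<lambda>i vs. vs ! i) [0..<length ss]"
  have "list_all2 (total_ic ss) (s # ss) ?hs"
    using assms(1) total_ic_identity by simp
  from total_ic_compose[OF assms(2) this] show ?thesis
    by (rule total_ic_cong) (simp add: map_nth_kinds del: map_map)
qed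

lemma total_ic_prec:
  assumes a: "total_ic ss t a" and h: "total_ic (Nat_kind # t # ss) t h" and b: "nat_ic ss b"
  shows "total_ic ss t (\<lambda>vs. rec_nat (a vs) (\<lambda>i v. h (NatV i # v # vs)) (b vs))"
proof -
  let ?r = "\<lambda>vs. rec_nat (a (tl vs)) (\<lambda>i v. h (NatV i # v # tl vs)) (the_nat (hd vs))"
  let ?p = "\<lambda>vs. case vs of
         NatV n # us \<Rightarrow> prec_opt (on_kinds ss (\<lambda>vs. Some (a vs)) us)
            (\<lambda>i v. on_kinds (Nat_kind # t # ss) (\<lambda>vs. Some (h vs)) (NatV i # v # us)) n
       | _ \<Rightarrow> None"
  have kind: "kind_of (rec_nat (a us) (\<lambda>i v. h (NatV i # v # us)) n) = t"
    if "map kind_of us = ss" for us n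
    by (induction n) (simp_all add: total_ic_kind[OF a] total_ic_kind[OF h] that)
  have rec: "prec_opt (on_kinds ss (\<lambda>vs. Some (a vs)) us)
            (\<lambda>i v. on_kinds (Nat_kind # t # ss) (\<lambda>vs. Some (h vs)) (NatV i # v # us)) n
     = Some (rec_nat (a us) (\<lambda>i v. h (NatV i # v # us)) n)" if "map kind_of us = ss" for us n
    by (induction n) (simp_all add: on_kinds_def that kind[OF that])
  have none: "prec_opt None h n = None" for h :: "nat \<Rightarrow> ('x, 'm) val \<Rightarrow> ('x, 'm) val option" and n
    by (induction n) auto
  have "?p = on_kinds (Nat_kind # ss) (\<lambda>vs. Some (?r vs))"
  proof
    fix vs :: "('x, 'm) val list"
    show "?p vs = on_kinds (Nat_kind # ss) (\<lambda>vs. Some (?r vs)) vs"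
    proof (cases "\<exists>n us. vs = NatV n # us")
      case True
      then obtain n us where vs: "vs = NatV n # us" by blast
      show ?thesis
      proof (cases "map kind_of us = ss")
        case True
        then show ?thesis by (simp add: vs rec) (simp add: on_kinds_def)
      next
        case False
        then show ?thesis by (simp add: vs on_kinds_def none)
      qed
    next
      case False
      then have "map kind_of vs \<noteq> Nat_kind # ss"
        by (auto simp: map_eq_Cons_conv kind_of_eq_iff)
      with False show ?thesis
        by (auto simp: on_kinds_def split: list.split val.split)
    qed
  qed
  moreover have "internally_computable x y (Nat_kind # ss) t ?p"
    using a h by (intro ic_prec) (auto simp: total_ic_def)
  ultimately have "total_ic (Nat_kind # ss) t ?r"
    unfolding total_ic_def using kind by (simp add: map_eq_Cons_conv) (auto simp: kind)
  from total_ic_let[OF b this] show ?thesis by simp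
qed

lemma total_ic_mu:
  assumes f: "nat_ic (Nat_kind # ss) (\<lambda>vs. f (the_nat (vs ! 0)) (drop 1 vs))"
    and ex: "\<And>vs. map kind_of vs = ss \<Longrightarrow> \<exists>n. f n vs = 0"
  shows "nat_ic ss (\<lambda>vs. LEAST n. f n vs = 0)"
proof -
  let ?f = "on_kinds (Nat_kind # ss) (\<lambda>vs. Some (NatV (f (the_nat (vs ! 0)) (drop 1 vs))))"
  let ?p = "\<lambda>us. map_option NatV (mu_opt (\<lambda>n. map_option the_nat (?f (NatV n # us))))"
  have "?p = on_kinds ss (\<lambda>vs. Some (NatV (LEAST n. f n vs = 0)))"
  proof
    fix us :: "('x, 'm) val list"
    show "?p us = on_kinds ss (\<lambda>vs. Some (NatV (LEAST n. f n vs = 0))) us"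
    proof (cases "map kind_of us = ss")
      case True
      then show ?thesis
        using ex[OF True] by (auto simp: on_kinds_def mu_opt_def)
    qed (simp add: on_kinds_def mu_opt_def)
  qed
  moreover have "internally_computable x y ss Nat_kind ?p"
    using f by (intro ic_mu) (simp add: total_ic_def)
  ultimately show ?thesis
    by (simp add: total_ic_def)
qed

lemma nat_ic_arg: "i < length ss \<Longrightarrow> ss ! i = Nat_kind \<Longrightarrow> nat_ic ss (\<lambda>vs. the_nat (vs ! i))"
proof (rule total_ic_cong)
  assume "i < length ss" "ss ! i = Nat_kind"
  then show "total_ic ss Nat_kind (\<lambda>vs. vs ! i)" using total_ic_proj[of i ss] by simp
  fix vs :: "('x, 'm) val list" assume "map kind_of vs = ss"
  with \<open>i < length ss\<close> \<open>ss ! i = Nat_kind\<close> have "kind_of (vs ! i) = Nat_kind"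
    by auto
  then show "vs ! i = NatV (the_nat (vs ! i))" by (cases "vs ! i") auto
qed

lemma X_ic_arg: "i < length ss \<Longrightarrow> ss ! i = X_kind \<Longrightarrow> X_ic ss (\<lambda>vs. the_X (vs ! i))"
proof (rule total_ic_cong)
  assume "i < length ss" "ss ! i = X_kind"
  then show "total_ic ss X_kind (\<lambda>vs. vs ! i)" using total_ic_proj[of i ss] by simp
  fix vs :: "('x, 'm) val list" assume "map kind_of vs = ss"
  with \<open>i < length ss\<close> \<open>ss ! i = X_kind\<close> have "kind_of (vs ! i) = X_kind"
    by auto
  then show "vs ! i = XV (the_X (vs ! i))" by (cases "vs ! i") auto
qed

lemma real_ic_arg: "i < length ss \<Longrightarrow> ss ! i = Real_kind \<Longrightarrow> real_ic ss (\<lambda>vs. the_real (vs ! i))"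
proof (rule total_ic_cong)
  assume "i < length ss" "ss ! i = Real_kind"
  then show "total_ic ss Real_kind (\<lambda>vs. vs ! i)" using total_ic_proj[of i ss] by simp
  fix vs :: "('x, 'm) val list" assume "map kind_of vs = ss"
  with \<open>i < length ss\<close> \<open>ss ! i = Real_kind\<close> have "kind_of (vs ! i) = Real_kind"
    by auto
  then show "vs ! i = RealV (the_real (vs ! i))" by (cases "vs ! i") auto
qed

lemma nat_ic_const: "nat_ic ss (\<lambda>vs. c)"
  by (rule total_ic_apply[OF ic_const, of ss "[]"]) (auto simp: on_kinds_def)

lemma nat_ic_Suc: "nat_ic ss a \<Longrightarrow> nat_ic ss (\<lambda>vs. Suc (a vs))"
  by (rule total_ic_apply[OF ic_suc, of ss "[\<lambda>vs. NatV (a vs)]"]) auto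

lemma real_ic_one: "real_ic ss (\<lambda>vs. 1)"
  by (rule total_ic_apply[OF ic_one, of ss "[]"]) (auto simp: on_kinds_def)

lemma real_ic_plus: "real_ic ss a \<Longrightarrow> real_ic ss b \<Longrightarrow> real_ic ss (\<lambda>vs. a vs + b vs)"
  by (rule total_ic_apply[OF ic_plus, of ss "[\<lambda>vs. RealV (a vs), \<lambda>vs. RealV (b vs)]"]) auto

lemma real_ic_minus: "real_ic ss a \<Longrightarrow> real_ic ss b \<Longrightarrow> real_ic ss (\<lambda>vs. a vs - b vs)"
  by (rule total_ic_apply[OF ic_minus, of ss "[\<lambda>vs. RealV (a vs), \<lambda>vs. RealV (b vs)]"]) auto

lemma real_ic_times: "real_ic ss a \<Longrightarrow> real_ic ss b \<Longrightarrow> real_ic ss (\<lambda>vs. a vs * b vs)"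
  by (rule total_ic_apply[OF ic_times, of ss "[\<lambda>vs. RealV (a vs), \<lambda>vs. RealV (b vs)]"]) auto

lemma real_ic_abs: "real_ic ss a \<Longrightarrow> real_ic ss (\<lambda>vs. \<bar>a vs\<bar>)"
  by (rule total_ic_apply[OF ic_abs, of ss "[\<lambda>vs. RealV (a vs)]"]) auto

lemma real_ic_zero: "real_ic ss (\<lambda>vs. 0)"
  using real_ic_minus[OF real_ic_one real_ic_one, of ss] by simp

lemma X_ic_enum: "nat_ic ss a \<Longrightarrow> X_ic ss (\<lambda>vs. x (a vs))"
  by (rule total_ic_apply[OF ic_enum_X, of ss "[\<lambda>vs. NatV (a vs)]"]) auto

lemma real_ic_dist: "X_ic ss a \<Longrightarrow> X_ic ss b \<Longrightarrow> real_ic ss (\<lambda>vs. dist (a vs) (b vs))"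
  by (rule total_ic_apply[OF ic_dist_X, of ss "[\<lambda>vs. XV (a vs), \<lambda>vs. XV (b vs)]"]) auto

lemma M_ic_enum: "nat_ic ss a \<Longrightarrow> M_ic ss (\<lambda>vs. y (a vs))"
  by (rule total_ic_apply[OF ic_enum_M, of ss "[\<lambda>vs. NatV (a vs)]"]) auto

lemma nat_ic_prec:
  assumes "nat_ic ss a" and "nat_ic ss b"
    and "nat_ic (Nat_kind # Nat_kind # ss)
           (\<lambda>vs. h (the_nat (vs ! 0)) (the_nat (vs ! 1)) (drop 2 vs))"
  shows "nat_ic ss (\<lambda>vs. rec_nat (a vs) (\<lambda>i v. h i v vs) (b vs))"
proof (rule total_ic_cong[OF total_ic_prec[OF assms(1,3,2)]])
  fix vs :: "('x, 'm) val list"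
  have "rec_nat (NatV (a vs))
      (\<lambda>i v. NatV (h (the_nat ((NatV i # v # vs) ! 0)) (the_nat ((NatV i # v # vs) ! 1))
                    (drop 2 (NatV i # v # vs)))) n =
    (NatV (rec_nat (a vs) (\<lambda>i v. h i v vs) n) :: ('x, 'm) val)" for n
    by (induction n) auto
  then show "rec_nat (NatV (a vs))
      (\<lambda>i v. NatV (h (the_nat ((NatV i # v # vs) ! 0)) (the_nat ((NatV i # v # vs) ! 1))
                    (drop 2 (NatV i # v # vs)))) (b vs) =
    (NatV (rec_nat (a vs) (\<lambda>i v. h i v vs) (b vs)) :: ('x, 'm) val)" .
qed

lemma real_ic_prec:
  assumes "real_ic ss a" and "nat_ic ss b"
    and "real_ic (Nat_kind # Real_kind # ss)
           (\<lambda>vs. h (the_nat (vs ! 0)) (the_real (vs ! 1)) (drop 2 vs))"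
  shows "real_ic ss (\<lambda>vs. rec_nat (a vs) (\<lambda>i v. h i v vs) (b vs))"
proof (rule total_ic_cong[OF total_ic_prec[OF assms(1,3,2)]])
  fix vs :: "('x, 'm) val list"
  have "rec_nat (RealV (a vs))
      (\<lambda>i v. RealV (h (the_nat ((NatV i # v # vs) ! 0)) (the_real ((NatV i # v # vs) ! 1))
                    (drop 2 (NatV i # v # vs)))) n =
    (RealV (rec_nat (a vs) (\<lambda>i v. h i v vs) n) :: ('x, 'm) val)" for n
    by (induction n) auto
  then show "rec_nat (RealV (a vs))
      (\<lambda>i v. RealV (h (the_nat ((NatV i # v # vs) ! 0)) (the_real ((NatV i # v # vs) ! 1))
                    (drop 2 (NatV i # v # vs)))) (b vs) =
    (RealV (rec_nat (a vs) (\<lambda>i v. h i v vs) (b vs)) :: ('x, 'm) val)" .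
qed

lemma M_ic_modified_limit:
  assumes "M_ic (Nat_kind # ss) (\<lambda>vs. w (the_nat (vs ! 0)) (drop 1 vs))"
  shows "M_ic ss (\<lambda>vs. lim (modified_seq (\<lambda>n. w n vs)))"
proof -
  let ?w = "on_kinds (Nat_kind # ss) (\<lambda>vs. Some (MV (w (the_nat (vs ! 0)) (drop 1 vs))))"
  have "internally_computable x y ss M_kind
      (\<lambda>us. map_option MV (modified_limit (\<lambda>n. map_option the_M (?w (NatV n # us)))))"
    using assms by (intro ic_ml_M) (simp add: total_ic_def)
  also have "(\<lambda>us. map_option MV (modified_limit (\<lambda>n. map_option the_M (?w (NatV n # us))))) =
      on_kinds ss (\<lambda>vs. Some (MV (lim (modified_seq (\<lambda>n. w n vs)))))"
    by (rule ext) (simp add: on_kinds_def modified_limit_def)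
  finally show ?thesis by (simp add: total_ic_def)
qed

lemma M_ic_accumulation:
  assumes "real_ic (Nat_kind # ss) (\<lambda>vs. a (the_nat (vs ! 0)) (drop 1 vs))"
    and "M_ic (Nat_kind # ss) (\<lambda>vs. g (the_nat (vs ! 0)) (drop 1 vs))"
    and "\<And>vs. map kind_of vs = ss \<Longrightarrow> accumulation (\<lambda>i. Some (a i vs)) (\<lambda>i. Some (g i vs)) = Some (v vs)"
  shows "M_ic ss v"
proof -
  let ?a = "on_kinds (Nat_kind # ss) (\<lambda>vs. Some (RealV (a (the_nat (vs ! 0)) (drop 1 vs))))"
  let ?g = "on_kinds (Nat_kind # ss) (\<lambda>vs. Some (MV (g (the_nat (vs ! 0)) (drop 1 vs))))"
  have "internally_computable x y ss M_kind
      (\<lambda>us. map_option MV (accumulation (\<lambda>n. map_option the_real (?a (NatV n # us)))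
         (\<lambda>n. map_option the_M (?g (NatV n # us)))))"
    using assms(1,2) by (intro ic_acc_M) (simp_all add: total_ic_def)
  also have "(\<lambda>us. map_option MV (accumulation (\<lambda>n. map_option the_real (?a (NatV n # us)))
         (\<lambda>n. map_option the_M (?g (NatV n # us))))) = on_kinds ss (\<lambda>vs. Some (MV (v vs)))"
  proof
    fix us :: "('x, 'm) val list"
    show "map_option MV (accumulation (\<lambda>n. map_option the_real (?a (NatV n # us)))
         (\<lambda>n. map_option the_M (?g (NatV n # us)))) = on_kinds ss (\<lambda>vs. Some (MV (v vs))) us"
      by (cases "map kind_of us = ss") (simp_all add: on_kinds_def assms(3), simp add: accumulation_def)
  qed
  finally show ?thesis by (simp add: total_ic_def)
qed

section \<open>Recursive arithmetic on natural numbers and reals\<close>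

lemma nat_ic_plus:
  assumes "nat_ic ss a" and "nat_ic ss b"
  shows "nat_ic ss (\<lambda>vs. a vs + b vs)"
proof -
  have "rec_nat m (\<lambda>_. Suc) n = m + n" for m n :: nat
    by (induction n) auto
  moreover have "nat_ic ss (\<lambda>vs. rec_nat (a vs) (\<lambda>i v. Suc v) (b vs))"
    by (intro nat_ic_prec assms nat_ic_Suc nat_ic_arg) auto
  ultimately show ?thesis by simp
qed

lemma nat_ic_times:
  assumes "nat_ic ss a" and "nat_ic ss b"
  shows "nat_ic ss (\<lambda>vs. a vs * b vs)"
proof -
  have "rec_nat 0 (\<lambda>_ v. v + m) n = m * n" for m n :: nat
    by (induction n) auto
  moreover have "nat_ic ss (\<lambda>vs. rec_nat 0 (\<lambda>i v. v + a vs) (b vs))"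
    by (intro nat_ic_prec nat_ic_const assms nat_ic_plus total_ic_weaken2 nat_ic_arg) auto
  ultimately show ?thesis by simp
qed

lemma nat_ic_pred:
  assumes "nat_ic ss a"
  shows "nat_ic ss (\<lambda>vs. a vs - 1)"
proof -
  have "rec_nat 0 (\<lambda>i _. i) n = n - 1" for n :: nat
    by (induction n) auto
  moreover have "nat_ic ss (\<lambda>vs. rec_nat 0 (\<lambda>i v. i) (a vs))"
    by (intro nat_ic_prec nat_ic_const assms nat_ic_arg) auto
  ultimately show ?thesis by simp
qed

lemma nat_ic_minus:
  assumes "nat_ic ss a" and "nat_ic ss b"
  shows "nat_ic ss (\<lambda>vs. a vs - b vs)"
proof -
  have "rec_nat m (\<lambda>_ v. v - 1) n = m - n" for m n :: nat
    by (induction n) auto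
  moreover have "nat_ic ss (\<lambda>vs. rec_nat (a vs) (\<lambda>i v. v - 1) (b vs))"
    by (intro nat_ic_prec assms nat_ic_pred nat_ic_arg) auto
  ultimately show ?thesis by simp
qed

lemma nat_ic_if:
  assumes "nat_ic ss a" and "nat_ic ss b" and "nat_ic ss c"
  shows "nat_ic ss (\<lambda>vs. if a vs = 0 then b vs else c vs)"
proof -
  have "rec_nat m (\<lambda>_ _. n) k = (if k = 0 then m else n)" for m n k :: nat
    by (cases k) auto
  moreover have "nat_ic ss (\<lambda>vs. rec_nat (b vs) (\<lambda>i v. c vs) (a vs))"
    by (intro nat_ic_prec assms total_ic_weaken2)
  ultimately show ?thesis by simp
qed

lemma real_ic_if:
  assumes "nat_ic ss a" and "real_ic ss b" and "real_ic ss c"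
  shows "real_ic ss (\<lambda>vs. if a vs = 0 then b vs else c vs)"
proof -
  have "rec_nat m (\<lambda>_ _. n) k = (if k = 0 then m else n)" for m n :: real and k
    by (cases k) auto
  moreover have "real_ic ss (\<lambda>vs. rec_nat (b vs) (\<lambda>i v. c vs) (a vs))"
    by (intro real_ic_prec assms total_ic_weaken2)
  ultimately show ?thesis by simp
qed

lemma real_ic_power2:
  assumes "nat_ic ss a"
  shows "real_ic ss (\<lambda>vs. 2 ^ a vs)"
proof -
  have "rec_nat 1 (\<lambda>_ v. v + v) k = (2::real) ^ k" for k
    by (induction k) auto
  moreover have "real_ic ss (\<lambda>vs. rec_nat 1 (\<lambda>i v. v + v) (a vs))"
    by (intro real_ic_prec assms real_ic_plus real_ic_one real_ic_arg) auto
  ultimately show ?thesis by simp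
qed

lemma real_ic_prod:
  assumes "nat_ic ss b" 
   and "real_ic (Nat_kind # Real_kind # ss) (\<lambda>vs. g (the_nat (vs ! 0)) (drop 2 vs))"
  shows "real_ic ss (\<lambda>vs. \<Prod>j<b vs. g j vs)"
proof -
  have "rec_nat 1 (\<lambda>j v. v * h j) k = (\<Prod>j<k. h j)" for k and h :: "nat \<Rightarrow> real"
    by (induction k) auto
  moreover have "real_ic ss (\<lambda>vs. rec_nat 1 (\<lambda>j v. v * g j vs) (b vs))"
    by (intro real_ic_prec assms real_ic_times real_ic_one real_ic_arg) auto
  ultimately show ?thesis by simp
qed

lemma nat_ic_prod_list:
  assumes "\<And>g. g \<in> set gs \<Longrightarrow> nat_ic ss g"
  shows "nat_ic ss (\<lambda>vs. prod_list (map (\<lambda>g. g vs) gs))"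
  using assms by (induction gs) (auto intro!: nat_ic_const[of _ 1] nat_ic_times simp flip: One_nat_def)

text \<open>
  The rounded square root is the least \<open>s\<close> with \<open>n < (s + 1)\<^sup>2\<close>; the comparison is expressed by
  truncated subtraction.
\<close>

lemma nat_ic_floor_sqrt:
  assumes "nat_ic ss a"
  shows "nat_ic ss (\<lambda>vs. floor_sqrt (a vs))"
proof -
  have least: "floor_sqrt n = (LEAST s. Suc n - Suc s * Suc s = 0)" for n
  proof (rule Least_equality[symmetric])
    show "Suc n - Suc (floor_sqrt n) * Suc (floor_sqrt n) = 0"
      using Suc_floor_sqrt_power2_gt[of n] by (simp add: power2_eq_square)
    fix s assume "Suc n - Suc s * Suc s = 0"
    then have "n < (Suc s)\<^sup>2" by (simp add: power2_eq_square)
    then show "floor_sqrt n \<le> s"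
      by (metis le_floor_sqrt_iff linorder_not_le not_less_eq_eq)
  qed
  have "nat_ic ss (\<lambda>vs. LEAST s. Suc (a vs) - Suc s * Suc s = 0)"
  proof (rule total_ic_mu)
    show "nat_ic (Nat_kind # ss)
        (\<lambda>vs. Suc (a (drop 1 vs)) - Suc (the_nat (vs ! 0)) * Suc (the_nat (vs ! 0)))"
      by (intro nat_ic_minus nat_ic_Suc nat_ic_times nat_ic_arg total_ic_weaken1 assms) auto
    show "\<exists>s. Suc (a vs) - Suc s * Suc s = 0" for vs :: "('x, 'm) val list"
      by (rule exI[of _ "a vs"]) simp
  qed
  then show ?thesis by (simp add: least)
qed


lemma nat_ic_fst_code: "nat_ic ss a \<Longrightarrow> nat_ic ss (\<lambda>vs. fst_code (a vs))"
  unfolding fst_code_def power2_eq_square by (intro nat_ic_minus nat_ic_times nat_ic_floor_sqrt)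

lemma nat_ic_snd_code: "nat_ic ss a \<Longrightarrow> nat_ic ss (\<lambda>vs. snd_code (a vs))"
  unfolding snd_code_def by (intro nat_ic_minus nat_ic_floor_sqrt nat_ic_fst_code)

lemma nat_ic_entry:
  assumes "nat_ic ss a" and "nat_ic ss b"
  shows "nat_ic ss (\<lambda>vs. entry (a vs) (b vs))"
proof -
  have "rec_nat c (\<lambda>_. snd_code) j = (snd_code ^^ j) c" for c j
    by (induction j) auto
  moreover have "nat_ic ss (\<lambda>vs. fst_code (rec_nat (a vs) (\<lambda>i v. snd_code v) (b vs)))"
    by (intro nat_ic_fst_code nat_ic_prec assms nat_ic_snd_code nat_ic_arg) auto
  ultimately show ?thesis by (simp add: entry_def)
qed

section \<open>Bounded simulation of computable functionals\<close>

text \<open>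
  The simulation is constructed by recursion schemes on argument lists of varying length, for
  which plain number lists are more convenient than environments.
\<close>

definition recursive :: "nat \<Rightarrow> (nat list \<Rightarrow> nat) \<Rightarrow> bool" where
  "recursive n e \<longleftrightarrow> nat_ic (replicate n Nat_kind) (\<lambda>vs. e (map the_nat vs))"

lemma recursive_cong:
  assumes "recursive n e" and "\<And>ns. length ns = n \<Longrightarrow> e ns = e' ns"
  shows "recursive n e'"
  using assms(1) unfolding recursive_def
  by (rule total_ic_cong) (metis assms(2) length_map length_replicate)

lemma recursive_arg: "i < n \<Longrightarrow> recursive n (\<lambda>ns. ns ! i)"
  unfolding recursive_def
  by (rule total_ic_cong[OF nat_ic_arg[of i]]) (auto dest: arg_cong[of _ _ length])

lemma nat_ic_recursive:
  assumes "recursive (length hs) e" and "\<And>h. h \<in> set hs \<Longrightarrow> nat_ic ss h"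
  shows "nat_ic ss (\<lambda>vs. e (map (\<lambda>h. h vs) hs))"
proof -
  have "list_all2 (total_ic ss) (replicate (length hs) Nat_kind) (map (\<lambda>h vs. NatV (h vs)) hs)"
    using assms(2) by (auto intro: list_all2_all_nthI)
  from total_ic_compose[OF assms(1)[unfolded recursive_def] this] show ?thesis
    by (simp add: comp_def)
qed

lemma recursive_compose:
  assumes "recursive (length hs) e" and "\<And>h. h \<in> set hs \<Longrightarrow> recursive n h"
  shows "recursive n (\<lambda>ns. e (map (\<lambda>h. h ns) hs))"
  using nat_ic_recursive[of "map (\<lambda>h vs. h (map the_nat vs)) hs" e] assms
  by (simp add: recursive_def comp_def image_iff) blast

lemma recursive_prec:
  assumes g: "recursive n g" and h: "recursive (Suc (Suc n)) h"
  shows "recursive (Suc n) (\<lambda>ns. rec_nat (g (tl ns)) (\<lambda>j v. h (j # v # tl ns)) (hd ns))"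
proof -
  have "nat_ic (replicate (Suc n) Nat_kind)
     (\<lambda>vs. rec_nat (g (map the_nat (drop 1 vs)))
        (\<lambda>j v. h (j # v # map the_nat (drop 1 vs))) (the_nat (vs ! 0)))"
  proof (rule nat_ic_prec)
    show "nat_ic (replicate (Suc n) Nat_kind) (\<lambda>vs. g (map the_nat (drop 1 vs)))"
      using total_ic_weaken1[OF g[unfolded recursive_def]] by simp
    show "nat_ic (replicate (Suc n) Nat_kind) (\<lambda>vs. the_nat (vs ! 0))"
      by (rule nat_ic_arg) auto
    let ?ss = "Nat_kind # Nat_kind # replicate (Suc n) Nat_kind"
    (* Position 2 holds the number of iterations, which the step function must not see. *)
    let ?is = "0 # 1 # [3..<n + 3]"
    have "nat_ic ?ss (\<lambda>vs. h (map (\<lambda>h. h vs) (map (\<lambda>i vs. the_nat (vs ! i)) ?is)))"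
      by (rule nat_ic_recursive) (use h in \<open>auto intro!: nat_ic_arg simp: nth_Cons' \<close>)
    then show "nat_ic ?ss (\<lambda>vs. h (the_nat (vs ! 0) # the_nat (vs ! 1) #
        map the_nat (drop 1 (drop 2 vs))))"
    proof (rule total_ic_cong)
      fix vs :: "('x, 'm) val list"
      assume "map kind_of vs = ?ss"
      then have "length vs = n + 3" by (auto dest: arg_cong[of _ _ length])
      then have "map (\<lambda>i. the_nat (vs ! i)) [3..<n + 3] = map the_nat (drop 3 vs)"
        by (intro nth_equalityI) auto
      moreover have "drop 1 (drop 2 vs) = drop 3 vs"
        by (simp add: numeral_eq_Suc)
      ultimately have "map (\<lambda>i. the_nat (vs ! i)) [3..<n + 3] = map the_nat (drop 1 (drop 2 vs))"
        by (simp only:)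
      then show "NatV (h (map (\<lambda>h. h vs) (map (\<lambda>i vs. the_nat (vs ! i)) ?is))) =
         NatV (h (the_nat (vs ! 0) # the_nat (vs ! 1) # map the_nat (drop 1 (drop 2 vs))))"
        by (simp add: comp_def)
    qed
  qed
  then show ?thesis
    unfolding recursive_def
    by (rule total_ic_cong) (auto simp: hd_conv_nth neq_Nil_conv map_eq_Cons_conv)
qed

lemma recursive_mu:
  assumes "recursive (Suc n) e" and "\<And>ns. length ns = n \<Longrightarrow> \<exists>i. e (i # ns) = 0"
  shows "recursive n (\<lambda>ns. LEAST i. e (i # ns) = 0)"
  unfolding recursive_def
proof (rule total_ic_mu)
  show "nat_ic (Nat_kind # replicate n Nat_kind) 
      (\<lambda>vs. e (the_nat (vs ! 0) # map the_nat (drop 1 vs)))"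
    by (rule total_ic_cong[OF assms(1)[unfolded recursive_def, simplified]])
      (auto simp: map_eq_Cons_conv)
  show "\<exists>i. e (i # map the_nat vs) = 0" if "map kind_of vs = replicate n Nat_kind"
    for vs :: "('x, 'm) val list"
    using assms(2)[of "map the_nat vs"] that by (metis length_map length_replicate)
qed

lemma recursive_const: "recursive n (\<lambda>_. c)"
  and recursive_Suc: "recursive n a \<Longrightarrow> recursive n (\<lambda>ns. Suc (a ns))"
  and recursive_minus: "recursive n a \<Longrightarrow> recursive n b \<Longrightarrow> recursive n (\<lambda>ns. a ns - b ns)"
  and recursive_if: "recursive n a \<Longrightarrow> recursive n b \<Longrightarrow> recursive n d \<Longrightarrow>
        recursive n (\<lambda>ns. if a ns = 0 then b ns else d ns)"
  and recursive_entry: "recursive n a \<Longrightarrow> recursive n b \<Longrightarrow> recursive n (\<lambda>ns. entry (a ns) (b ns))"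
  and recursive_prod_list: "(\<And>g. g \<in> set gs \<Longrightarrow> recursive n g) \<Longrightarrow>
        recursive n (\<lambda>ns. prod_list (map (\<lambda>g. g ns) gs))"
  unfolding recursive_def
  using nat_ic_prod_list[of "map (\<lambda>h vs. h (map the_nat vs)) gs"]
  by (auto intro!: nat_ic_const nat_ic_Suc nat_ic_minus nat_ic_if nat_ic_entry simp: comp_def)


text \<open>
  The function \<open>e\<close> takes two further arguments: \<open>c\<close> codes the oracle and \<open>t\<close> bounds both the
  oracle positions that may be read and the searches. The value \<open>0\<close> means that no result has been
  found, \<open>Suc m\<close> that the result is \<open>m\<close>. The first conjunct says that results found are
  correct for every oracle that agrees with \<open>c\<close> below \<open>t\<close>, the second that results are found
  for all sufficiently large \<open>t\<close>. The two arguments come last, so that the schemes, which add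
  arguments in front, act on them as on parameters.
\<close>

definition stage_evaluates ::
  "nat \<Rightarrow> ((nat \<Rightarrow> nat) list \<Rightarrow> nat list \<Rightarrow> nat option) \<Rightarrow> (nat list \<Rightarrow> nat) \<Rightarrow> bool" where
  "stage_evaluates n F e \<longleftrightarrow>
     (\<forall>ns c t \<gamma> m. length ns = n \<longrightarrow> (\<forall>j<t. entry c j = \<gamma> j) \<longrightarrow> e (ns @ [c, t]) = Suc m \<longrightarrow>
        F [\<gamma>] ns = Some m) \<and>
     (\<forall>ns \<gamma> m. length ns = n \<longrightarrow> F [\<gamma>] ns = Some m \<longrightarrow>
        (\<forall>\<^sub>F t in sequentially. \<forall>c. (\<forall>j<t. entry c j = \<gamma> j) \<longrightarrow> e (ns @ [c, t]) = Suc m))"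

lemma stage_evaluates_sound:
  "stage_evaluates n F e \<Longrightarrow> length ns = n \<Longrightarrow> (\<And>j. j < t \<Longrightarrow> entry c j = \<gamma> j) \<Longrightarrow>
    e (ns @ [c, t]) = Suc m \<Longrightarrow> F [\<gamma>] ns = Some m"
  unfolding stage_evaluates_def by blast

lemma stage_evaluates_complete:
  "stage_evaluates n F e \<Longrightarrow> length ns = n \<Longrightarrow> F [\<gamma>] ns = Some m \<Longrightarrow>
    \<forall>\<^sub>F t in sequentially. \<forall>c. (\<forall>j<t. entry c j = \<gamma> j) \<longrightarrow> e (ns @ [c, t]) = Suc m"
  unfolding stage_evaluates_def by blast

lemma stage_evaluatesI:
  assumes "\<And>ns c t \<gamma> m. length ns = n \<Longrightarrow> (\<And>j. j < t \<Longrightarrow> entry c j = \<gamma> j) \<Longrightarrow>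
      e (ns @ [c, t]) = Suc m \<Longrightarrow> F [\<gamma>] ns = Some m"
    and "\<And>ns \<gamma> m. length ns = n \<Longrightarrow> F [\<gamma>] ns = Some m \<Longrightarrow>
        \<forall>\<^sub>F t in sequentially. \<forall>c. (\<forall>j<t. entry c j = \<gamma> j) \<longrightarrow> e (ns @ [c, t]) = Suc m"
  shows "stage_evaluates n F e"
  unfolding stage_evaluates_def using assms by blast

lemma those_eq_Some_iff: "those xs = Some ys \<longleftrightarrow> xs = map Some ys"
  by (induction xs arbitrary: ys) (auto split: option.splits)

text \<open>
  The product is \<open>0\<close> exactly if some intermediate result is missing; present ones are shifted
  down before use. For each of the finitely many intermediate results all large \<open>t\<close> suffice,
  so a common bound exists.
\<close>

lemma stage_evaluates_comp:
  assumes F: "stage_evaluates (length Gs) F eF"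
    and G: "\<And>G. G \<in> set Gs \<Longrightarrow> stage_evaluates n G (eG G)"
  shows "stage_evaluates n
      (\<lambda>\<gamma>s ns. if length ns = n
                then Option.bind (those (map (\<lambda>G. G \<gamma>s ns) Gs)) (F \<gamma>s) else None)
      (\<lambda>ns. if prod_list (map (\<lambda>G. eG G ns) Gs) = 0 then 0
            else eF (map (\<lambda>G. eG G ns - 1) Gs @ [ns ! n, ns ! Suc n]))"
    (is "stage_evaluates _ _ ?e")
proof (rule stage_evaluatesI)
  fix ns :: "nat list" and c t \<gamma> m
  assume ns: "length ns = n" and c: "\<And>j. j < t \<Longrightarrow> entry c j = \<gamma> j"
  let ?ns = "ns @ [c, t]"
  assume "(if prod_list (map (\<lambda>G. eG G ?ns) Gs) = 0 then 0
      else eF (map (\<lambda>G. eG G ?ns - 1) Gs @ [?ns ! n, ?ns ! Suc n])) = Suc m"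
  then have nz0: "prod_list (map (\<lambda>G. eG G ?ns) Gs) \<noteq> 0"
    and eF0: "eF (map (\<lambda>G. eG G ?ns - 1) Gs @ [?ns ! n, ?ns ! Suc n]) = Suc m"
    by (simp_all only: not_False_eq_True nat.distinct split: if_splits)
  have nz: "eG G ?ns \<noteq> 0" if "G \<in> set Gs" for G
    using nz0 that by (auto simp: prod_list_zero_iff)
  have eF: "eF (map (\<lambda>G. eG G ?ns - 1) Gs @ [c, t]) = Suc m"
    using eF0 ns by (simp add: nth_append)
  have "G [\<gamma>] ns = Some (eG G ?ns - 1)" if "G \<in> set Gs" for G
    using stage_evaluates_sound[OF G[OF that] ns c] nz[OF that] by simp
  then have "those (map (\<lambda>G. G [\<gamma>] ns) Gs) = Some (map (\<lambda>G. eG G ?ns - 1) Gs)"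
    by (simp add: those_eq_Some_iff)
  moreover have "F [\<gamma>] (map (\<lambda>G. eG G ?ns - 1) Gs) = Some m"
    by (rule stage_evaluates_sound[OF F _ c eF]) simp
  ultimately show "(if length ns = n
     then Option.bind (those (map (\<lambda>G. G [\<gamma>] ns) Gs)) (F [\<gamma>]) else None) = Some m"
    using ns by simp
next
  fix ns :: "nat list" and \<gamma> m
  assume ns: "length ns = n" and
    "(if length ns = n
     then Option.bind (those (map (\<lambda>G. G [\<gamma>] ns) Gs)) (F [\<gamma>]) else None) = Some m"
  then obtain ms where ms: "map (\<lambda>G. G [\<gamma>] ns) Gs = map Some ms" and m: "F [\<gamma>] ms = Some m"
    by (auto simp: bind_eq_Some_conv those_eq_Some_iff)
  have len: "length ms = length Gs" using ms by (metis length_map)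
  let ?H = "\<lambda>t. \<forall>G\<in>set Gs. \<forall>c. (\<forall>j<t. entry c j = \<gamma> j) \<longrightarrow>
      eG G (ns @ [c, t]) = Suc (the (G [\<gamma>] ns))"
  have "\<forall>\<^sub>F t in sequentially. ?H t"
  proof (rule eventually_ball_finite, simp, rule ballI)
    fix G assume "G \<in> set Gs"
    then have "G [\<gamma>] ns \<in> set (map Some ms)"
      by (simp flip: ms)
    then show "\<forall>\<^sub>F t in sequentially. \<forall>c. (\<forall>j<t. entry c j = \<gamma> j) \<longrightarrow>
        eG G (ns @ [c, t]) = Suc (the (G [\<gamma>] ns))"
      by (intro stage_evaluates_complete[OF G[OF \<open>G \<in> set Gs\<close>] ns]) auto
  qed
  moreover have "\<forall>\<^sub>F t in sequentially. \<forall>c. (\<forall>j<t. entry c j = \<gamma> j) \<longrightarrow>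
      eF (ms @ [c, t]) = Suc m"
    by (rule stage_evaluates_complete[OF F len m])
  ultimately show "\<forall>\<^sub>F t in sequentially. \<forall>c. (\<forall>j<t. entry c j = \<gamma> j) \<longrightarrow>
    ?e (ns @ [c, t]) = Suc m"
  proof eventually_elim
    case (elim t)
    show ?case
    proof (intro allI impI)
      fix c assume c: "\<forall>j<t. entry c j = \<gamma> j"
      have *: "\<And>G. G \<in> set Gs \<Longrightarrow> eG G (ns @ [c, t]) = Suc (the (G [\<gamma>] ns))"
        using elim(1) c by blast
      have "map (\<lambda>G. the (G [\<gamma>] ns)) Gs = map the (map (\<lambda>G. G [\<gamma>] ns) Gs)"
        by simp
      also have "\<dots> = ms"
        by (simp only: ms) simp
      finally have "map (\<lambda>G. eG G (ns @ [c, t]) - 1) Gs = ms"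
        using * by (simp cong: map_cong)
      moreover have "prod_list (map (\<lambda>G. eG G (ns @ [c, t])) Gs) \<noteq> 0"
        using * by (auto simp: prod_list_zero_iff)
      moreover have "eF (ms @ [c, t]) = Suc m"
        using elim(2) c by blast
      ultimately show "(if prod_list (map (\<lambda>G. eG G (ns @ [c, t])) Gs) = 0 then 0
          else eF (map (\<lambda>G. eG G (ns @ [c, t]) - 1) Gs @
             [(ns @ [c, t]) ! n, (ns @ [c, t]) ! Suc n])) = Suc m"
        using ns by (simp add: nth_append)
    qed
  qed
qed

lemma stage_evaluates_prec:
  assumes G: "stage_evaluates n G eG" and H: "stage_evaluates (Suc (Suc n)) H eH"
  shows "stage_evaluates (Suc n)
      (\<lambda>\<gamma>s ns. case ns of i # ms \<Rightarrow> prec_opt (G \<gamma>s ms) (\<lambda>j v. H \<gamma>s (j # v # ms)) i | [] \<Rightarrow> None)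
      (\<lambda>ns. rec_nat (eG (tl ns)) (\<lambda>j v. if v = 0 then 0 else eH (j # (v - 1) # tl ns)) (hd ns))"
    (is "stage_evaluates _ ?P ?e")
proof (rule stage_evaluatesI)
  fix ns c t \<gamma> m
  assume "length ns = Suc n" and c: "\<And>j. j < t \<Longrightarrow> entry c j = \<gamma> j"
    and e: "?e (ns @ [c, t]) = Suc m"
  then obtain i ms where ns: "ns = i # ms" and ms: "length ms = n"
    by (auto simp: length_Suc_conv)
  have "rec_nat (eG (ms @ [c, t])) (\<lambda>j v. if v = 0 then 0 else eH (j # (v - 1) # ms @ [c, t])) i =
      Suc m \<Longrightarrow> prec_opt (G [\<gamma>] ms) (\<lambda>j v. H [\<gamma>] (j # v # ms)) i = Some m"
  proof (induction i arbitrary: m)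
    case 0
    then show ?case using stage_evaluates_sound[OF G ms c] by simp
  next
    case (Suc i)
    let ?v = "rec_nat (eG (ms @ [c, t])) (\<lambda>j v. if v = 0 then 0 else eH (j # (v - 1) # ms @ [c, t])) i"
    from Suc.prems have v: "?v = Suc (?v - 1)" and "eH ((i # (?v - 1) # ms) @ [c, t]) = Suc m"
      by (auto split: if_splits)
    then have "H [\<gamma>] (i # (?v - 1) # ms) = Some m"
      using ms by (intro stage_evaluates_sound[OF H _ c]) simp_all
    with Suc.IH[OF v] show ?case by simp
  qed
  with e show "?P [\<gamma>] ns = Some m"
    unfolding ns append_Cons list.sel list.case by blast
next
  fix ns \<gamma> m
  assume "length ns = Suc n" and P: "?P [\<gamma>] ns = Some m"
  then obtain i ms where ns: "ns = i # ms" and ms: "length ms = n"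
    by (auto simp: length_Suc_conv)
  have "prec_opt (G [\<gamma>] ms) (\<lambda>j v. H [\<gamma>] (j # v # ms)) i = Some m \<Longrightarrow>
      \<forall>\<^sub>F t in sequentially. \<forall>c. (\<forall>j<t. entry c j = \<gamma> j) \<longrightarrow>
      rec_nat (eG (ms @ [c, t])) (\<lambda>j v. if v = 0 then 0 else eH (j # (v - 1) # ms @ [c, t])) i =
      Suc m"
  proof (induction i arbitrary: m)
    case 0
    then show ?case using stage_evaluates_complete[OF G ms] by simp
  next
    case (Suc i)
    then obtain v where v: "prec_opt (G [\<gamma>] ms) (\<lambda>j v. H [\<gamma>] (j # v # ms)) i = Some v"
      and m: "H [\<gamma>] (i # v # ms) = Some m"
      by (auto simp: bind_eq_Some_conv)
    from ms have "length (i # v # ms) = Suc (Suc n)" by simp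
    from Suc.IH[OF v] stage_evaluates_complete[OF H this m] show ?case
      by eventually_elim simp
  qed
  with P show "\<forall>\<^sub>F t in sequentially. \<forall>c. (\<forall>j<t. entry c j = \<gamma> j) \<longrightarrow>
      ?e (ns @ [c, t]) = Suc m"
    unfolding ns append_Cons list.sel list.case by blast
qed

text \<open>
  The search stops at the first \<open>i\<close> where \<open>eF\<close> either has found the result \<open>0\<close> (value \<open>1\<close>) or has
  found no result (value \<open>0\<close>), and at \<open>t\<close> at the latest. It succeeds only in the former case;
  then all earlier values have been found to be positive, so the minimum is the right one for
  every oracle that agrees with \<open>c\<close>.
\<close>

lemma stage_evaluates_mu:
  assumes F: "stage_evaluates (Suc n) F eF"
  defines "l \<equiv> \<lambda>ns. LEAST i. (if ns ! Suc n - i = 0 then 0 else eF (i # ns) - 1) = 0"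
  shows "stage_evaluates n (\<lambda>\<gamma>s ns. mu_opt (\<lambda>i. F \<gamma>s (i # ns)))
     (\<lambda>ns. if eF (l ns # ns) = 0 then 0 else if eF (l ns # ns) - 1 = 0 then Suc (l ns) else 0)"
     (is "stage_evaluates _ _ ?e")
proof (rule stage_evaluatesI)
  fix ns c t \<gamma> m
  assume ns: "length ns = n" and c: "\<And>j. j < t \<Longrightarrow> entry c j = \<gamma> j"
    and e: "?e (ns @ [c, t]) = Suc m"
  then have m: "m = l (ns @ [c, t])" and em: "eF ((m # ns) @ [c, t]) = Suc 0"
    by (auto split: if_splits)
  have below: "eF ((i # ns) @ [c, t]) = Suc (Suc (eF ((i # ns) @ [c, t]) - 2))" if "i < m" for i
    using not_less_Least[OF that[unfolded m l_def]] by (auto split: if_splits)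
  have "F [\<gamma>] (m # ns) = Some 0"
    by (rule stage_evaluates_sound[OF F _ c em]) (use ns in auto)
  moreover have "F [\<gamma>] (i # ns) = Some (Suc (eF ((i # ns) @ [c, t]) - 2))" if "i < m" for i
    by (rule stage_evaluates_sound[OF F _ c below[OF that]]) (use ns in auto)
  moreover from calculation have "(LEAST i. F [\<gamma>] (i # ns) = Some 0) = m"
    by (intro Least_equality) (auto intro: leI)
  ultimately show "mu_opt (\<lambda>i. F [\<gamma>] (i # ns)) = Some m"
    unfolding mu_opt_def by auto
next
  fix ns \<gamma> m
  assume ns: "length ns = n" and mu: "mu_opt (\<lambda>i. F [\<gamma>] (i # ns)) = Some m"
  then have ex: "\<exists>i. F [\<gamma>] (i # ns) = Some 0 \<and> (\<forall>j<i. F [\<gamma>] (j # ns) \<noteq> None)"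
    and m: "m = (LEAST i. F [\<gamma>] (i # ns) = Some 0)"
    by (auto simp: mu_opt_def split: if_splits)
  then have zero: "F [\<gamma>] (m # ns) = Some 0" by (metis (mono_tags, lifting) LeastI)
  have pos: "F [\<gamma>] (i # ns) \<noteq> Some 0" "F [\<gamma>] (i # ns) \<noteq> None" if "i < m" for i
    using ex m that not_less_Least by (metis (mono_tags, lifting), 
      metis (mono_tags, lifting) Least_le order_less_le_trans)
  have "\<forall>\<^sub>F t in sequentially. \<forall>i\<in>{..m}. \<forall>c. (\<forall>j<t. entry c j = \<gamma> j) \<longrightarrow>
      eF ((i # ns) @ [c, t]) = Suc (the (F [\<gamma>] (i # ns)))"
  proof (rule eventually_ball_finite, simp, rule ballI)
    fix i assume "i \<in> {..m}"
    then have "i \<le> m" by simp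
    then have "F [\<gamma>] (i # ns) = Some (the (F [\<gamma>] (i # ns)))"
      using zero pos[of i] by (cases "i = m") auto
    then show "\<forall>\<^sub>F t in sequentially. \<forall>c. (\<forall>j<t. entry c j = \<gamma> j) \<longrightarrow>
        eF ((i # ns) @ [c, t]) = Suc (the (F [\<gamma>] (i # ns)))"
      by (intro stage_evaluates_complete[OF F]) (use ns in auto)
  qed
  then show "\<forall>\<^sub>F t in sequentially. \<forall>c. (\<forall>j<t. entry c j = \<gamma> j) \<longrightarrow>
      ?e (ns @ [c, t]) = Suc m"
    using eventually_gt_at_top[of m]
  proof eventually_elim
    case (elim t)
    show ?case
    proof (intro allI impI)
      fix c assume "\<forall>j<t. entry c j = \<gamma> j"
      with elim have e: "eF (i # ns @ [c, t]) = Suc (the (F [\<gamma>] (i # ns)))" if "i \<le> m" for i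
        using that by auto
      have "l (ns @ [c, t]) = m"
        unfolding l_def
      proof (rule Least_equality)
        show "(if (ns @ [c, t]) ! Suc n - m = 0 then 0 else eF (m # ns @ [c, t]) - 1) = 0"
          using e[of m] zero by simp
        fix i assume "(if (ns @ [c, t]) ! Suc n - i = 0 then 0 else eF (i # ns @ [c, t]) - 1) = 0"
        then show "m \<le> i"
          using e[of i] pos[of i] elim(2) ns by (cases "i < m") (auto simp: nth_append split: if_splits)
      qed
      with e[of m] zero show "?e (ns @ [c, t]) = Suc m" by simp
    qed
  qed
qed

text \<open>
  An oracle query at a position not below \<open>t\<close> has no result. This and the cut-off of searches
  are the only places where the bound enters.
\<close>

lemma stage_evaluation:
  assumes "computable_functional 1 n F"
  shows "\<exists>e. recursive (n + 2) e \<and> stage_evaluates n F e"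
  using assms
proof induction
  case cf_zero
  show ?case
    by (rule exI[of _ "\<lambda>_. Suc 0"]) (auto intro!: recursive_const stage_evaluatesI split: if_splits)
next
  case cf_suc
  have "recursive (1 + 2) (\<lambda>ns. Suc (Suc (ns ! 0)))"
    by (intro recursive_Suc recursive_arg) auto
  moreover have "stage_evaluates 1 (\<lambda>\<gamma>s ns. case ns of [n] \<Rightarrow> Some (Suc n) | _ \<Rightarrow> None)
      (\<lambda>ns. Suc (Suc (ns ! 0)))"
    by (rule stage_evaluatesI) (auto simp: length_Suc_conv)
  ultimately show ?case by blast
next
  case (cf_proj i n)
  then have "recursive (n + 2) (\<lambda>ns. Suc (ns ! i))"
    by (intro recursive_Suc recursive_arg) auto
  moreover have "stage_evaluates n (\<lambda>\<gamma>s ns. if length ns = n then Some (ns ! i) else None)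
      (\<lambda>ns. Suc (ns ! i))"
    by (rule stage_evaluatesI) (use cf_proj in \<open>auto simp: nth_append\<close>)
  ultimately show ?case by blast
next
  case (cf_oracle i)
  have "recursive (1 + 2) (\<lambda>ns. if ns ! 2 - ns ! 0 = 0 then 0 else Suc (entry (ns ! 1) (ns ! 0)))"
    by (intro recursive_if recursive_Suc recursive_arg recursive_minus recursive_const recursive_entry) auto
  moreover have "stage_evaluates 1 (\<lambda>\<gamma>s ns. case ns of [n] \<Rightarrow> Some ((\<gamma>s ! i) n) | _ \<Rightarrow> None)
      (\<lambda>ns. if ns ! 2 - ns ! 0 = 0 then 0 else Suc (entry (ns ! 1) (ns ! 0)))"
  proof (rule stage_evaluatesI)
    fix ns and \<gamma> :: "nat \<Rightarrow> nat" and m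
    assume "length ns = 1" and "(case ns of [n] \<Rightarrow> Some (([\<gamma>] ! i) n) | _ \<Rightarrow> None) = Some m"
    then obtain k where k: "ns = [k]" "m = \<gamma> k"
      using cf_oracle by (auto simp: length_Suc_conv)
    show "\<forall>\<^sub>F t in sequentially. \<forall>c. (\<forall>j<t. entry c j = \<gamma> j) \<longrightarrow>
      (if (ns @ [c, t]) ! 2 - (ns @ [c, t]) ! 0 = 0 then 0
       else Suc (entry ((ns @ [c, t]) ! 1) ((ns @ [c, t]) ! 0))) = Suc m"
      using eventually_gt_at_top[of k] by eventually_elim (simp add: k)
  qed (use cf_oracle in \<open>auto simp: length_Suc_conv split: if_splits\<close>)
  ultimately show ?case by blast
next
  case (cf_comp Gs F n)
  then obtain eF where eF: "recursive (length Gs + 2) eF" "stage_evaluates (length Gs) F eF"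
    by blast
  have "\<forall>G. \<exists>e. G \<in> set Gs \<longrightarrow> recursive (n + 2) e \<and> stage_evaluates n G e"
    using cf_comp.IH by blast
  then obtain eG where eG: "\<And>G. G \<in> set Gs \<Longrightarrow> recursive (n + 2) (eG G) \<and> stage_evaluates n G (eG G)"
    by metis
  let ?hs = "map (\<lambda>G ns. eG G ns - 1) Gs @ [\<lambda>ns. ns ! n, \<lambda>ns. ns ! Suc n]"
  have "recursive (n + 2) (\<lambda>ns. eF (map (\<lambda>h. h ns) ?hs))"
  proof (rule recursive_compose)
    show "recursive (length ?hs) eF" using eF by simp
    show "recursive (n + 2) h" if "h \<in> set ?hs" for h
      using that eG by (auto intro!: recursive_arg recursive_minus recursive_const)
  qed
  moreover have "recursive (n + 2) (\<lambda>ns. prod_list (map (\<lambda>g. g ns) (map eG Gs)))"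
    by (rule recursive_prod_list) (use eG in auto)
  ultimately have "recursive (n + 2) (\<lambda>ns. if prod_list (map (\<lambda>G. eG G ns) Gs) = 0 then 0
            else eF (map (\<lambda>G. eG G ns - 1) Gs @ [ns ! n, ns ! Suc n]))"
    by (intro recursive_if recursive_const) (simp_all add: comp_def)
  with stage_evaluates_comp[OF eF(2)] eG show ?case by blast
next
  case (cf_prec n G H)
  then obtain eG eH where G: "recursive (n + 2) eG" "stage_evaluates n G eG"
    and H: "recursive (Suc (Suc n) + 2) eH" "stage_evaluates (Suc (Suc n)) H eH"
    by blast
  let ?h = "\<lambda>ns. if ns ! 1 = 0 then 0 else eH (map (\<lambda>h. h ns)
     ((\<lambda>ns. ns ! 0) # (\<lambda>ns. ns ! 1 - 1) # map (\<lambda>i ns. ns ! i) [2..<n + 4]))"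
  have "recursive (n + 4) ?h"
  proof (intro recursive_if recursive_const recursive_compose)
    have "length ((\<lambda>ns. ns ! 0) # (\<lambda>ns. ns ! 1 - 1) # map (\<lambda>i ns :: nat list. ns ! i) [2..<n + 4]) =
        Suc (Suc n) + 2"
      by simp
    with H(1) show "recursive (length ((\<lambda>ns. ns ! 0) # (\<lambda>ns. ns ! 1 - 1) #
        map (\<lambda>i ns :: nat list. ns ! i) [2..<n + 4])) eH"
      by (simp only:)
  qed (auto intro!: recursive_arg recursive_minus recursive_const)
  then have "recursive (n + 4)
      (\<lambda>ns. (\<lambda>j v. if v = 0 then 0 else eH (j # (v - 1) # drop 2 ns)) (ns ! 0) (ns ! 1))"
  proof (rule recursive_cong)
    fix ns :: "nat list" assume "length ns = n + 4"
    then have "map (\<lambda>i. ns ! i) [2..<n + 4] = drop 2 ns"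
      by (intro nth_equalityI) auto
    then show "?h ns = (\<lambda>j v. if v = 0 then 0 else eH (j # (v - 1) # drop 2 ns)) (ns ! 0) (ns ! 1)"
      by (simp add: comp_def)
  qed
  then have "recursive (Suc (Suc (n + 2)))
      (\<lambda>ns. (\<lambda>j v. if v = 0 then 0 else eH (j # (v - 1) # drop 2 ns)) (ns ! 0) (ns ! 1))"
    by (simp add: numeral_eq_Suc)
  from recursive_prec[OF G(1) this] have "recursive (Suc n + 2)
     (\<lambda>ns. rec_nat (eG (tl ns)) (\<lambda>j v. if v = 0 then 0 else eH (j # (v - 1) # tl ns)) (hd ns))"
    by (simp cong: if_cong)
  with stage_evaluates_prec[OF G(2) H(2)] show ?case by blast
next
  case (cf_mu n F)
  then obtain eF where F: "recursive (Suc n + 2) eF" "stage_evaluates (Suc n) F eF"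
    by blast
  define l where "l = (\<lambda>ns. LEAST i. (if ns ! Suc n - i = 0 then 0 else eF (i # ns) - 1) = 0)"
  let ?f = "\<lambda>ns. if ns ! Suc (Suc n) - ns ! 0 = 0 then 0 else eF ns - 1"
  have "recursive (n + 2) (\<lambda>ns. LEAST i. ?f (i # ns) = 0)"
  proof (rule recursive_mu)
    show "recursive (Suc (n + 2)) ?f"
      using F(1) by (intro recursive_if recursive_minus recursive_const recursive_arg) auto
    show "\<exists>i. ?f (i # ns) = 0" for ns
      by (rule exI[of _ "ns ! Suc n"]) simp
  qed
  then have l: "recursive (n + 2) l" by (simp add: l_def)
  let ?hs = "l # map (\<lambda>i ns. ns ! i) [0..<n + 2]"
  have "recursive (n + 2) (\<lambda>ns. eF (map (\<lambda>h. h ns) ?hs))"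
    using F(1) l by (intro recursive_compose) (auto intro!: recursive_arg)
  then have eF: "recursive (n + 2) (\<lambda>ns. eF (l ns # ns))"
  proof (rule recursive_cong)
    fix ns :: "nat list" assume "length ns = n + 2"
    then have "map (\<lambda>i. ns ! i) [0..<n + 2] = ns"
      by (metis map_nth)
    then show "eF (map (\<lambda>h. h ns) ?hs) = eF (l ns # ns)"
      by (simp add: comp_def del: upt_Suc)
  qed
  have "recursive (n + 2)
     (\<lambda>ns. if eF (l ns # ns) = 0 then 0 else if eF (l ns # ns) - 1 = 0 then Suc (l ns) else 0)"
    by (intro recursive_if recursive_minus recursive_const recursive_Suc l eF)
  with stage_evaluates_mu[OF F(2)] show ?case unfolding l_def by blast
qed

section \<open>Averaging over all prefixes\<close>

lemma real_ic_prefix_weight: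
  assumes "nat_ic ss c" and "nat_ic ss t" and "X_ic ss p"
  shows "real_ic ss (\<lambda>vs. prefix_weight x (c vs) (t vs) (p vs))"
  unfolding prefix_weight_def Let_def
  by (intro real_ic_times real_ic_prod real_ic_plus real_ic_minus real_ic_abs real_ic_one
      real_ic_power2 real_ic_dist X_ic_enum nat_ic_entry nat_ic_Suc nat_ic_arg assms
      total_ic_weaken2) simp_all

text \<open>
  An index \<open>i\<close> of the average codes a triple: the code and the bound of a prefix, and a
  third component that makes each prefix occur infinitely often. The \<open>k\<close>-th average
  uses output number \<open>k + 3\<close>, which is \<open>2 * (1/2) ^ (k + 3) = (1/2) ^ (k + 2)\<close>-close.
\<close>

lemma M_ic_of_stage_evaluation:
  assumes dense: "closure (range x) = UNIV"
    and rec: "recursive 3 e" and stage: "stage_evaluates 1 F e"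
    and F: "\<And>\<gamma> p. represents x \<gamma> p \<Longrightarrow>
      \<exists>\<delta>. (\<forall>n. F [\<gamma>] [n] = Some (\<delta> n)) \<and> represents y \<delta> (f p)"
  shows "M_ic [X_kind] (\<lambda>vs. f (the_X (vs ! 0)))"
proof -
  define v where "v i k = e [k + 3, fst_code i, fst_code (snd_code i)]" for i k
  define a where "a i k p =
    (if v i k = 0 then 0 else prefix_weight x (fst_code i) (fst_code (snd_code i)) p)" for i k p
  have near: "norm (y (v i k - 1) - f p) \<le> (1/2) ^ (k + 2)" if "0 < a i k p" for i k p
  proof -
    let ?c = "fst_code i" and ?t = "fst_code (snd_code i)"
    have "v i k \<noteq> 0" and weight: "0 < prefix_weight x ?c ?t p"
      using that by (auto simp: a_def split: if_splits)
    then have v: "e ([k + 3] @ [?c, ?t]) = Suc (v i k - 1)"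
      by (simp add: v_def)
    obtain \<gamma> where \<gamma>: "represents x \<gamma> p" "\<forall>j\<le>?t. \<gamma> j = entry ?c j"
      using name_extends_prefix[OF dense, of ?t "entry ?c" p] weight
      by (auto simp: prefix_weight_pos_iff)
    from F[OF \<gamma>(1)] obtain \<delta> where \<delta>: "\<And>n. F [\<gamma>] [n] = Some (\<delta> n)" "represents y \<delta> (f p)"
      by blast
    have "F [\<gamma>] [k + 3] = Some (v i k - 1)"
      by (rule stage_evaluates_sound[OF stage _ _ v]) (simp_all add: \<gamma>(2))
    then have "v i k - 1 = \<delta> (k + 3)" using \<delta>(1) by simp
    with represents_dist[OF \<delta>(2), of "k + 3"] show ?thesis
      by (simp add: dist_norm power_add eval_nat_numeral)
  qed
  have exceeds: "\<exists>n. 1 < (\<Sum>i\<le>n. a i k p)" for k p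
  proof -
    obtain \<gamma> where \<gamma>: "represents x \<gamma> p"
      "\<And>j. dist (x (\<gamma> j)) (x (\<gamma> (Suc j))) < (1/2) ^ j" "\<And>j. dist (x (\<gamma> j)) p < (1/2) ^ j"
      using strict_name[OF dense] by blast
    obtain m where "F [\<gamma>] [k + 3] = Some m"
      using F[OF \<gamma>(1)] by blast
    from stage_evaluates_complete[OF stage _ this]
    obtain t where t: "\<And>c. (\<forall>j<t. entry c j = \<gamma> j) \<Longrightarrow> e [k + 3, c, t] = Suc m"
      by (auto simp: eventually_sequentially)
    (* One entry more than the simulation reads, since the weight also involves entry t. *)
    obtain c where c: "\<forall>j<Suc t. entry c j = \<gamma> j"
      using exists_code by blast
    let ?i = "\<lambda>r. pair_code c (pair_code t r)"
    have w: "a (?i r) k p = prefix_weight x c t p" for r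
      using t[of c] c by (simp add: a_def v_def)
    have "0 < prefix_weight x c t p"
      using \<gamma>(2,3) c by (simp add: prefix_weight_pos_iff)
    moreover have "infinite (range ?i)"
      by (rule range_inj_infinite) (metis injI snd_pair_code)
    ultimately show ?thesis
      by (intro partial_sum_exceeds_1[of _ "range ?i"]) (auto simp: w, simp add: a_def prefix_weight_nonneg)
  qed
  define u where
    "u k p = the (accumulation (\<lambda>i. Some (a i k p)) (\<lambda>i. Some (y (v i k - 1))))" for k p
  have acc: "\<exists>u. accumulation (\<lambda>i. Some (a i k p)) (\<lambda>i. Some (y (v i k - 1))) = Some u \<and>
      norm (u - f p) \<le> (1/2) ^ (k + 2)" for k p
    by (rule accumulation_near[OF _ exceeds near]) (simp_all add: a_def prefix_weight_nonneg)
  have u: "accumulation (\<lambda>i. Some (a i k p)) (\<lambda>i. Some (y (v i k - 1))) = Some (u k p)"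
    and u_near: "norm (u k p - f p) \<le> (1/2) ^ (k + 2)" for k p
    using acc[of k p] by (auto simp: u_def)
  have v_ic: "nat_ic ss (\<lambda>vs. v (i vs) (k vs))" if "nat_ic ss i" "nat_ic ss k" for ss i k
  proof -
    let ?hs = "[\<lambda>vs. Suc (Suc (Suc (k vs))), \<lambda>vs. fst_code (i vs),
        \<lambda>vs. fst_code (snd_code (i vs))]"
    have "nat_ic ss (\<lambda>vs. e (map (\<lambda>h. h vs) ?hs))"
    proof (rule nat_ic_recursive)
      show "recursive (length ?hs) e" using rec by (simp add: numeral_3_eq_3)
      show "nat_ic ss h" if "h \<in> set ?hs" for h
        using that \<open>nat_ic ss i\<close> \<open>nat_ic ss k\<close>
        by (auto intro!: nat_ic_Suc nat_ic_fst_code nat_ic_snd_code)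
    qed
    then show ?thesis by (simp add: v_def numeral_3_eq_3)
  qed
  have "M_ic [Nat_kind, X_kind] (\<lambda>vs. u (the_nat (vs ! 0)) (the_X (vs ! 1)))"
  proof (rule M_ic_accumulation)
    show "real_ic [Nat_kind, Nat_kind, X_kind]
        (\<lambda>vs. a (the_nat (vs ! 0)) (the_nat (drop 1 vs ! 0)) (the_X (drop 1 vs ! 1)))"
      unfolding a_def
      by (intro real_ic_if v_ic real_ic_prefix_weight nat_ic_fst_code nat_ic_snd_code
          real_ic_zero total_ic_weaken1 nat_ic_arg X_ic_arg) simp_all
    show "M_ic [Nat_kind, Nat_kind, X_kind]
        (\<lambda>vs. y (v (the_nat (vs ! 0)) (the_nat (drop 1 vs ! 0)) - 1))"
      by (intro M_ic_enum nat_ic_pred v_ic total_ic_weaken1 nat_ic_arg) simp_all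
    show "accumulation (\<lambda>i. Some (a i (the_nat (vs ! 0)) (the_X (vs ! 1))))
        (\<lambda>i. Some (y (v i (the_nat (vs ! 0)) - 1))) =
        Some (u (the_nat (vs ! 0)) (the_X (vs ! 1)))" for vs :: "('x, 'm) val list"
      by (rule u)
  qed
  then have "M_ic [Nat_kind, X_kind] (\<lambda>vs. u (the_nat (vs ! 0)) (the_X (drop 1 vs ! 0)))"
    by (rule total_ic_cong) (auto simp: map_eq_Cons_conv)
  from M_ic_modified_limit[of "[X_kind]" "\<lambda>k vs. u k (the_X (vs ! 0))", OF this]
  show ?thesis
    by (simp add: lim_modified_seq[OF u_near])
qed

end

theorem theorem3p16:
  fixes x :: "nat \<Rightarrow> 'x::complete_space"
    and y :: "nat \<Rightarrow> 'm::banach"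
    and f :: "'x \<Rightarrow> 'm"
  assumes "computable_metric_space x"
    and "computable_banach_space y"
    and "externally_computable x y f"
  shows "internally_computable x y [X_kind] M_kind
           (\<lambda>vs. case vs of [XV p] \<Rightarrow> Some (MV (f p)) | _ \<Rightarrow> None)"
proof -
  have dense: "closure (range x) = UNIV"
    using assms(1) by (simp add: computable_metric_space_def)
  obtain F where F: "computable_functional 1 1 F"
    and name: "\<And>\<gamma> p. represents x \<gamma> p \<Longrightarrow>
      \<exists>\<delta>. (\<forall>n. F [\<gamma>] [n] = Some (\<delta> n)) \<and> represents y \<delta> (f p)"
    using assms(3) unfolding externally_computable_def by blast
  obtain e where "recursive x y 3 e" and "stage_evaluates 1 F e"
    using stage_evaluation[OF F, of x y] by (auto simp: numeral_3_eq_3)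
  from M_ic_of_stage_evaluation[OF dense this name]
  have "internally_computable x y [X_kind] M_kind
      (on_kinds [X_kind] (\<lambda>vs. Some (MV (f (the_X (vs ! 0))))))"
    by (simp add: total_ic_def)
  also have "on_kinds [X_kind] (\<lambda>vs. Some (MV (f (the_X (vs ! 0))))) =
      (\<lambda>vs. case vs of [XV p] \<Rightarrow> Some (MV (f p)) | _ \<Rightarrow> None)"
    by (rule ext) (auto simp: on_kinds_def map_eq_Cons_conv kind_of_eq_iff
        split: list.split val.split)
  finally show ?thesis .
qed

end
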